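(* a) Let $f\in H_1$ and $$\omega_{H_1}\left(\frac1{M_n},f\right)=o\left(\frac1n\right)\quad\text{when } n\to\infty .$$ Then $\|S_kf-f\|_{H_1}\to0$ when $k\to\infty$. b) There exists a martingale $f\in H_1$ for which $$\omega_{H_1}\left(\frac1{M_{2M_n}},f\right)=O\left(\frac1{M_n}\right)\quad\text{when } n\to\infty$$ and $\|S_kf-f\|_{1}\nrightarrow0$ when $k\to\infty$.
   Context: $\mathbb N_+$ is the set of positive integers, $\mathbb N=\mathbb N_+\cup\{0\}$. Fix a bounded sequence $m=(m_0,m_1,\dots)$ of integers $m_k\ge 2$. $G_m=\prod_{k\ge0}Z_{m_k}$, where $Z_{m_k}=\{0,\dots,m_k-1\}$ is the additive group modulo $m_k$, with the product of the discrete topologies; $\mu$ is the Haar measure with $\mu(G_m)=1$. $M_0:=1$, $M_{k+1}:=m_kM_k$; every $n\in\mathbb N$ is uniquely $n=\sum_{j\ge0}n_jM_j$ with $n_j\in Z_{m_j}$. $r_k(x):=\exp(2\pi i x_k/m_k)$, $\psi_n:=\prod_{k\ge0}r_k^{n_k}$ (Vilenkin system). $I_0(x):=G_m$, $I_n(x):=\{y: y_0=x_0,\dots,y_{n-1}=x_{n-1}\}$; $\mathcal F_n$ is the $\sigma$-algebra generated by $\{I_n(x):x\in G_m\}$. For $g\in L_1(G_m)$: $\widehat g(k):=\int g\overline{\psi_k}\,d\mu$, $S_ng:=\sum_{k=0}^{n-1}\widehat g(k)\psi_k$. A martingale is a sequence $f=(f^{(n)}:n\in\mathbb N)$ of integrable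 functions with $f^{(n)}$ $\mathcal F_n$-measurable and $S_{M_n}f^{(k)}=f^{(n)}$ for $n\le k$; $f^*:=\sup_n|f^{(n)}|$; $H_p$ is the set of martingales with $\|f\|_{H_p}:=\|f^*\|_p<\infty$, where $\|g\|_p:=(\int|g|^pd\mu)^{1/p}$ for functions and $\|f\|_p:=\sup_n\|f^{(n)}\|_p$ for martingales. For a martingale, $\widehat f(i):=\lim_k\int f^{(k)}\overline{\psi_i}\,d\mu$ and $S_nf:=\sum_{k=0}^{n-1}\widehat f(k)\psi_k$. A function $g\in L_1$ is identified with the martingale $(S_{M_k}g:k\in\mathbb N)$; thus $S_nf-f$ is the martingale $(S_{M_k}S_nf-f^{(k)}:k\in\mathbb N)$. The modulus of continuity in $H_p$ is $\omega_{H_p}(1/M_n,f):=\|f-S_{M_n}f\|_{H_p}$. *)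

theory Defs
  imports "HOL-Probability.Probability"
begin

section \<open>The Vilenkin group and its Haar measure\<close>

text \<open>
  Throughout, \<open>m :: nat \<Rightarrow> nat\<close> is the generating sequence; \<open>m k \<ge> 2\<close> and boundedness are
  hypotheses of the theorem.  Group elements are functions \<open>nat \<Rightarrow> nat\<close>, the residue group
  \<open>Z\<^bsub>m k\<^esub>\<close> being represented by \<open>{..<m k}\<close>.
\<close>

definition vtop :: "(nat \<Rightarrow> nat) \<Rightarrow> (nat \<Rightarrow> nat) topology" where
  "vtop m = product_topology (\<lambda>k. discrete_topology {..<m k}) UNIV"

definition vgroup :: "(nat \<Rightarrow> nat) \<Rightarrow> (nat \<Rightarrow> nat) set" where
  "vgroup m = {x. \<forall>k. x k < m k}"

definition vadd :: "(nat \<Rightarrow> nat) \<Rightarrow> (nat \<Rightarrow> nat) \<Rightarrow> (nat \<Rightarrow> nat) \<Rightarrow> (nat \<Rightarrow> nat)" where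
  "vadd m x y = (\<lambda>k. (x k + y k) mod m k)"

text \<open>
  Translation-invariant Borel probability measures.  No regularity clause is needed:
  every finite Borel measure on a compact metrizable space is regular.
\<close>

definition is_haar_prob :: "(nat \<Rightarrow> nat) \<Rightarrow> (nat \<Rightarrow> nat) measure \<Rightarrow> bool" where
  "is_haar_prob m N \<longleftrightarrow> prob_space N \<and>
     sets N = sigma_sets (topspace (vtop m)) {U. openin (vtop m) U} \<and>
     (\<forall>x\<in>vgroup m. \<forall>A\<in>sets N. emeasure N (vadd m x ` A) = emeasure N A)"

text \<open>
  Existence and uniqueness are proved below (\<open>haar_is_haar_prob\<close>, \<open>is_haar_prob_unique\<close>), and
  \<open>haar_eq_PiM\<close> identifies this measure with the product of the uniform measures.
\<close>

definition haar :: "(nat \<Rightarrow> nat) \<Rightarrow> (nat \<Rightarrow> nat) measure" where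
  "haar m = (THE N. is_haar_prob m N)"

definition vint :: "(nat \<Rightarrow> nat) \<Rightarrow> nat \<Rightarrow> (nat \<Rightarrow> nat) \<Rightarrow> (nat \<Rightarrow> nat) set" where
  "vint m n x = {y \<in> vgroup m. \<forall>j<n. y j = x j}"

definition vsigma :: "(nat \<Rightarrow> nat) \<Rightarrow> nat \<Rightarrow> (nat \<Rightarrow> nat) measure" where
  "vsigma m n = sigma (vgroup m) (vint m n ` vgroup m)"


section \<open>The Vilenkin system and Fourier partial sums\<close>

definition vM :: "(nat \<Rightarrow> nat) \<Rightarrow> nat \<Rightarrow> nat" where
  "vM m k = (\<Prod>j<k. m j)"

text \<open>
  The \<open>j\<close>-th digit of \<open>n\<close> in the mixed-radix expansion \<open>n = (\<Sum>j. n\<^sub>j * M\<^sub>j)\<close>, see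
  \<open>vdigit_sum\<close> and \<open>vdigit_unique\<close> below.
\<close>

definition vdigit :: "(nat \<Rightarrow> nat) \<Rightarrow> nat \<Rightarrow> nat \<Rightarrow> nat" where
  "vdigit m n j = (n div vM m j) mod m j"

definition rademacher :: "(nat \<Rightarrow> nat) \<Rightarrow> nat \<Rightarrow> (nat \<Rightarrow> nat) \<Rightarrow> complex" where
  "rademacher m k x = exp (2 * of_real pi * \<i> * of_nat (x k) / of_nat (m k))"

text \<open>
  The product over all \<open>k\<close>, restricted to the (finite, see \<open>finite_vdigit_support\<close>) set of
  indices whose factor is not a zeroth power.
\<close>

definition vilenkin :: "(nat \<Rightarrow> nat) \<Rightarrow> nat \<Rightarrow> (nat \<Rightarrow> nat) \<Rightarrow> complex" where
  "vilenkin m n x = (\<Prod>k\<in>{k. vdigit m n k \<noteq> 0}. rademacher m k x ^ vdigit m n k)"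

definition fcoeff :: "(nat \<Rightarrow> nat) \<Rightarrow> ((nat \<Rightarrow> nat) \<Rightarrow> complex) \<Rightarrow> nat \<Rightarrow> complex" where
  "fcoeff m g k = (LINT x|haar m. g x * cnj (vilenkin m k x))"

definition psum :: "(nat \<Rightarrow> nat) \<Rightarrow> nat \<Rightarrow> ((nat \<Rightarrow> nat) \<Rightarrow> complex) \<Rightarrow> (nat \<Rightarrow> nat) \<Rightarrow> complex" where
  "psum m n g x = (\<Sum>k<n. fcoeff m g k * vilenkin m k x)"


section \<open>Martingales and the Hardy space\<close>

type_synonym vmart = "nat \<Rightarrow> (nat \<Rightarrow> nat) \<Rightarrow> complex"

definition is_vmart :: "(nat \<Rightarrow> nat) \<Rightarrow> vmart \<Rightarrow> bool" where
  "is_vmart m f \<longleftrightarrow>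
     (\<forall>n. integrable (haar m) (f n) \<and> f n \<in> borel_measurable (vsigma m n)) \<and>
     (\<forall>n k. n \<le> k \<longrightarrow> (\<forall>x\<in>vgroup m. psum m (vM m n) (f k) x = f n x))"

text \<open>All norms take values in \<open>ennreal\<close>, so that an infinite norm is \<open>\<infinity>\<close> and not \<open>0\<close>.\<close>

definition vmaximal :: "vmart \<Rightarrow> (nat \<Rightarrow> nat) \<Rightarrow> ennreal" where
  "vmaximal f x = (SUP n. ennreal (norm (f n x)))"

definition H1_norm :: "(nat \<Rightarrow> nat) \<Rightarrow> vmart \<Rightarrow> ennreal" where
  "H1_norm m f = (\<integral>\<^sup>+ x. vmaximal f x \<partial>haar m)"

definition mart_L1_norm :: "(nat \<Rightarrow> nat) \<Rightarrow> vmart \<Rightarrow> ennreal" where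
  "mart_L1_norm m f = (SUP n. \<integral>\<^sup>+ x. ennreal (norm (f n x)) \<partial>haar m)"

definition H1 :: "(nat \<Rightarrow> nat) \<Rightarrow> vmart set" where
  "H1 m = {f. is_vmart m f \<and> H1_norm m f < \<infinity>}"

definition mart_fcoeff :: "(nat \<Rightarrow> nat) \<Rightarrow> vmart \<Rightarrow> nat \<Rightarrow> complex" where
  "mart_fcoeff m f i = lim (\<lambda>k. fcoeff m (f k) i)"

definition mart_psum :: "(nat \<Rightarrow> nat) \<Rightarrow> nat \<Rightarrow> vmart \<Rightarrow> (nat \<Rightarrow> nat) \<Rightarrow> complex" where
  "mart_psum m n f x = (\<Sum>k<n. mart_fcoeff m f k * vilenkin m k x)"

definition mart_of :: "(nat \<Rightarrow> nat) \<Rightarrow> ((nat \<Rightarrow> nat) \<Rightarrow> complex) \<Rightarrow> vmart" where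
  "mart_of m g = (\<lambda>k. psum m (vM m k) g)"

definition mart_diff :: "vmart \<Rightarrow> vmart \<Rightarrow> vmart" where
  "mart_diff f g = (\<lambda>k x. f k x - g k x)"

text \<open>\<open>omega_H1 m n f\<close> is the modulus of continuity at scale \<open>1 / vM m n\<close>.\<close>

definition omega_H1 :: "(nat \<Rightarrow> nat) \<Rightarrow> nat \<Rightarrow> vmart \<Rightarrow> ennreal" where
  "omega_H1 m n f = H1_norm m (mart_diff f (mart_of m (mart_psum m (vM m n) f)))"


section \<open>Adequacy of the digits\<close>

lemma vM_0 [simp]: "vM m 0 = 1"
  and vM_Suc [simp]: "vM m (Suc k) = m k * vM m k"
  by (simp_all add: vM_def)

lemma vM_pos:
  assumes "\<And>k. m k \<ge> 2"
  shows "vM m k > 0"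
proof -
  have "0 < m j" for j using assms[of j] by simp
  then show ?thesis unfolding vM_def by (intro prod_pos) auto
qed

lemma vM_gt:
  assumes "\<And>k. m k \<ge> 2"
  shows "k < vM m k"
proof (induction k)
  case (Suc k)
  have "2 * vM m k \<le> m k * vM m k" using assms by (intro mult_right_mono) auto
  moreover have "Suc k < 2 * vM m k" using Suc by linarith
  ultimately show ?case unfolding vM_Suc by linarith
qed simp

lemma vdigit_less:
  assumes "\<And>k. m k \<ge> 2"
  shows "vdigit m n j < m j"
  using assms[of j] by (simp add: vdigit_def)

lemma vM_mono:
  assumes "\<And>k. m k \<ge> 2" "i \<le> j"
  shows "vM m i \<le> vM m j"
  using assms(2)
proof (induction rule: dec_induct)
  case (step n)
  have "1 * vM m n \<le> m n * vM m n" using assms(1)[of n] by (intro mult_right_mono) auto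
  with step show ?case unfolding vM_Suc by linarith
qed simp

lemma finite_vdigit_support:
  assumes "\<And>k. m k \<ge> 2"
  shows "finite {k. vdigit m n k \<noteq> 0}"
proof (rule finite_subset)
  show "{k. vdigit m n k \<noteq> 0} \<subseteq> {..n}"
  proof (rule subsetI, rule ccontr)
    fix k assume k: "k \<in> {k. vdigit m n k \<noteq> 0}" "k \<notin> {..n}"
    then have "n < vM m k" using vM_gt[of m k, OF assms] by auto
    with k show False by (simp add: vdigit_def)
  qed
qed simp

lemma vdigit_sum_mod: "(\<Sum>j<N. vdigit m n j * vM m j) = n mod vM m N"
proof (induction N)
  case (Suc N)
  have "n mod (vM m N * m N) = vM m N * (n div vM m N mod m N) + n mod vM m N"
    by (rule mod_mult2_eq)
  with Suc show ?case by (simp add: vdigit_def mult.commute)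
qed simp

lemma vdigit_sum: "n < vM m N \<Longrightarrow> n = (\<Sum>j<N. vdigit m n j * vM m j)"
  by (simp add: vdigit_sum_mod)

lemma digit_sum_less:
  assumes "\<And>k. m k \<ge> 2" "\<And>j. j < N \<Longrightarrow> a j < m j"
  shows "(\<Sum>j<N. a j * vM m j) < vM m N"
  using assms(2)
proof (induction N)
  case (Suc N)
  have "(\<Sum>j<N. a j * vM m j) < vM m N" using Suc by auto
  then have "(\<Sum>j<Suc N. a j * vM m j) < Suc (a N) * vM m N" by simp
  also have "\<dots> \<le> m N * vM m N" using Suc.prems[of N] by (intro mult_right_mono) auto
  finally show ?case by simp
qed simp

lemma vdigit_unique:
  assumes "\<And>k. m k \<ge> 2" "\<And>j. j < N \<Longrightarrow> a j < m j" "i < N"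
  shows "vdigit m (\<Sum>j<N. a j * vM m j) i = a i"
  using assms(2,3)
proof (induction N)
  case (Suc N)
  let ?s = "\<Sum>j<N. a j * vM m j"
  have s: "?s < vM m N" using assms(1) Suc.prems by (intro digit_sum_less) auto
  have aN: "a N < m N" using Suc.prems by auto
  show ?case
  proof (cases "i = N")
    case True
    with s aN show ?thesis by (simp add: vdigit_def)
  next
    case False
    then have i: "i < N" using Suc.prems by simp
    have "vM m (Suc i) dvd vM m N"
      using i by (auto simp: vM_def simp del: prod.lessThan_Suc intro!: prod_dvd_prod_subset)
    then obtain c where "vM m N = vM m (Suc i) * c" by (rule dvdE)
    then have c: "vM m N = vM m i * (m i * c)" unfolding vM_Suc by (simp only: ac_simps)
    have pos: "vM m i > 0" using assms(1) by (rule vM_pos)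
    have "(?s + a N * vM m N) div vM m i = ?s div vM m i + a N * (m i * c)"
    proof -
      have e: "a N * vM m N = (a N * (m i * c)) * vM m i" unfolding c by (simp only: ac_simps)
      show ?thesis unfolding e using pos by (subst div_mult_self1) auto
    qed
    moreover have "(?s div vM m i + a N * (m i * c)) mod m i = (?s div vM m i) mod m i"
    proof -
      have e: "a N * (m i * c) = m i * (a N * c)" by (simp only: ac_simps)
      show ?thesis unfolding e by (rule mod_mult_self2)
    qed
    ultimately have "vdigit m (\<Sum>j<Suc N. a j * vM m j) i = vdigit m ?s i"
      by (simp add: vdigit_def)
    also have "\<dots> = a i" using Suc i by auto
    finally show ?thesis .
  qed
qed simp


section \<open>Existence and uniqueness of the Haar measure\<close>

lemma topspace_vtop [simp]: "topspace (vtop m) = vgroup m"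
  by (auto simp: vtop_def vgroup_def PiE_def)

lemma vint_subset: "vint m n x \<subseteq> vgroup m"
  by (auto simp: vint_def)

lemma vint_Int: "vint m n x \<inter> vint m k y = {} \<or> (\<exists>z\<in>vgroup m. vint m n x \<inter> vint m k y = vint m (max n k) z)"
proof (cases "vint m n x \<inter> vint m k y = {}")
  case False
  then obtain z where z: "z \<in> vint m n x" "z \<in> vint m k y" by auto
  then have "vint m n x \<inter> vint m k y = vint m (max n k) z"
    by (auto simp: vint_def less_max_iff_disj)
  with z show ?thesis by (auto simp: vint_def)
qed simp

abbreviation vcyls :: "(nat \<Rightarrow> nat) \<Rightarrow> (nat \<Rightarrow> nat) set set" where
  "vcyls m \<equiv> insert {} {vint m n x |n x. x \<in> vgroup m}"

lemma Int_stable_vcyls: "Int_stable (vcyls m)"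
  unfolding Int_stable_def
proof (intro ballI)
  fix A B assume "A \<in> vcyls m" "B \<in> vcyls m"
  then consider "A = {} \<or> B = {}" | n x k y where "A = vint m n x" "B = vint m k y" by blast
  then show "A \<inter> B \<in> vcyls m"
  proof cases
    case 2
    then show ?thesis using vint_Int[of m n x k y] by blast
  qed auto
qed

lemma vcyls_Pow: "vcyls m \<subseteq> Pow (vgroup m)"
  using vint_subset by auto

lemma countable_vcyls: "countable (vcyls m)"
proof -
  have "vint m n x = (\<lambda>(n, xs). {y \<in> vgroup m. \<forall>j<n. y j = xs ! j}) (n, map x [0..<n])" for n x
    by (auto simp: vint_def)
  then have "{vint m n x |n x. x \<in> vgroup m} \<subseteq>
      range (\<lambda>(n::nat, xs::nat list). {y \<in> vgroup m. \<forall>j<n. y j = xs ! j})" by blast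
  then have "countable {vint m n x |n x. x \<in> vgroup m}"
    by (rule countable_subset) auto
  then show ?thesis by simp
qed

lemma openin_vint: "openin (vtop m) (vint m n x)"
proof -
  have "vint m n x = (\<Pi>\<^sub>E k\<in>UNIV. if k < n then {..<m k} \<inter> {x k} else {..<m k})" 
    by (auto simp: vint_def vgroup_def PiE_def Pi_def split: if_splits)
  moreover have "openin (vtop m) \<dots>"
    unfolding vtop_def
    by (rule product_topology_basis) (auto intro: finite_subset[of _ "{..<n}"] split: if_splits)
  ultimately show ?thesis by simp
qed

lemma open_vint_nhd:
  assumes U: "openin (vtop m) U" and x: "x \<in> U"
  shows "\<exists>n. vint m n x \<subseteq> U"
proof -
  obtain V where V: "finite {i. V i \<noteq> {..<m i}}" "x \<in> Pi\<^sub>E UNIV V" "Pi\<^sub>E UNIV V \<subseteq> U"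
    using U x unfolding vtop_def openin_product_topology_alt by (auto; metis)
  obtain n where n: "\<And>i. V i \<noteq> {..<m i} \<Longrightarrow> i < n"
  proof -
    obtain n where "\<forall>i\<in>{i. V i \<noteq> {..<m i}}. i < n"
      using V(1) finite_nat_set_iff_bounded by blast
    then show thesis using that by blast
  qed
  have "vint m n x \<subseteq> Pi\<^sub>E UNIV V"
  proof
    fix y assume y: "y \<in> vint m n x"
    have "y i \<in> V i" for i
    proof (cases "i < n")
      case True then show ?thesis using y V(2) by (auto simp: vint_def)
    next
      case False
      then have "V i = {..<m i}" using n by auto
      then show ?thesis using y by (auto simp: vint_def vgroup_def)
    qed
    then show "y \<in> Pi\<^sub>E UNIV V" by auto
  qed
  with V(3) show ?thesis by auto
qed

lemma open_in_sigma_vcyls: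
  assumes U: "openin (vtop m) U"
  shows "U \<in> sigma_sets (vgroup m) (vcyls m)"
proof -
  have sub: "U \<subseteq> vgroup m" using openin_subset[OF U] by simp
  have "U = \<Union>{C \<in> vcyls m. C \<subseteq> U}"
  proof
    show "U \<subseteq> \<Union>{C \<in> vcyls m. C \<subseteq> U}"
    proof
      fix x assume x: "x \<in> U"
      obtain n where "vint m n x \<subseteq> U" using open_vint_nhd[OF U x] by auto
      moreover have "x \<in> vint m n x" "x \<in> vgroup m" using x sub by (auto simp: vint_def)
      ultimately show "x \<in> \<Union>{C \<in> vcyls m. C \<subseteq> U}" by blast
    qed
  qed auto
  moreover have "\<Union>{C \<in> vcyls m. C \<subseteq> U} \<in> sigma_sets (vgroup m) (vcyls m)"
    using countable_vcyls vcyls_Pow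
    by (intro sigma_sets_UNION) (auto intro: countable_subset[of _ "vcyls m"])
  ultimately show ?thesis by simp
qed

lemma sigma_open_eq_vcyls:
  "sigma_sets (vgroup m) {U. openin (vtop m) U} = sigma_sets (vgroup m) (vcyls m)"
proof (rule sigma_sets_eqI)
  fix A assume "A \<in> vcyls m"
  then have "openin (vtop m) A" using openin_vint by auto
  then show "A \<in> sigma_sets (vgroup m) {U. openin (vtop m) U}" by auto
qed (use open_in_sigma_vcyls in blast)

abbreviation vprod :: "(nat \<Rightarrow> nat) \<Rightarrow> (nat \<Rightarrow> nat) measure" where
  "vprod m \<equiv> Pi\<^sub>M UNIV (\<lambda>k. uniform_count_measure {..<m k})"

lemma vint_eq_emb:
  "vint m n x = prod_emb UNIV (\<lambda>k. uniform_count_measure {..<m k}) {..<n} (\<Pi>\<^sub>E j\<in>{..<n}. {..<m j} \<inter> {x j})"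
proof (rule set_eqI)
  fix y
  have "y \<in> vint m n x \<longleftrightarrow> (\<forall>k. y k \<in> {..<m k}) \<and> (\<forall>j\<in>{..<n}. y j \<in> {..<m j} \<inter> {x j})"
    by (auto simp: vint_def vgroup_def)
  then show "y \<in> vint m n x \<longleftrightarrow> y \<in> prod_emb UNIV (\<lambda>k. uniform_count_measure {..<m k}) {..<n}
      (\<Pi>\<^sub>E j\<in>{..<n}. {..<m j} \<inter> {x j})"
    unfolding prod_emb_iff restrict_PiE_iff space_uniform_count_measure by (simp; blast)
qed

lemma sets_vprod: "sets (vprod m) = sigma_sets (vgroup m) (vcyls m)"
proof -
  have sp: "(\<Pi>\<^sub>E i\<in>UNIV. space (uniform_count_measure {..<m i})) = vgroup m"
    by (auto simp: space_uniform_count_measure vgroup_def PiE_def)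
  have "sets (vprod m) = sigma_sets (vgroup m)
      {{f \<in> vgroup m. f i \<in> A} |i A. A \<in> sets (uniform_count_measure {..<m i})}"
    unfolding sets_PiM_single sp by simp
  also have "\<dots> = sigma_sets (vgroup m) (vcyls m)"
  proof (rule sigma_sets_eqI)
    fix C assume "C \<in> {{f \<in> vgroup m. f i \<in> A} |i A. A \<in> sets (uniform_count_measure {..<m i})}"
    then obtain i A where C: "C = {f \<in> vgroup m. f i \<in> A}" "A \<subseteq> {..<m i}"
      unfolding sets_uniform_count_measure by blast
    have "C = {f \<in> topspace (vtop m). f i \<in> A}" using C by simp
    moreover have "openin (vtop m) {f \<in> topspace (vtop m). f i \<in> A}"
      unfolding vtop_def
    proof (rule openin_continuous_map_preimage)
      show "continuous_map (product_topology (\<lambda>k. discrete_topology {..<m k}) UNIV)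
          (discrete_topology {..<m i}) (\<lambda>f. f i)"
        by (rule continuous_map_product_projection) simp
      show "openin (discrete_topology {..<m i}) A" using C(2) by simp
    qed
    ultimately have "openin (vtop m) C" by (rule ssubst)
    then show "C \<in> sigma_sets (vgroup m) (vcyls m)" by (rule open_in_sigma_vcyls)
  next
    fix C assume C: "C \<in> vcyls m"
    have "vint m n x \<in> sets (vprod m)" for n x
      unfolding vint_eq_emb by (rule sets_PiM_I) (auto simp: sets_uniform_count_measure)
    with C have "C \<in> sets (vprod m)" by blast
    then show "C \<in> sigma_sets (vgroup m)
      {{f \<in> vgroup m. f i \<in> A} |i A. A \<in> sets (uniform_count_measure {..<m i})}"
      unfolding sets_PiM_single sp by simp
  qed
  finally show ?thesis .
qed

lemma space_vprod: "space (vprod m) = vgroup m"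
  by (auto simp: space_PiM space_uniform_count_measure vgroup_def PiE_def)

lemma eq_on_vcylsI:
  assumes "sets N = sigma_sets (vgroup m) (vcyls m)" "sets N' = sigma_sets (vgroup m) (vcyls m)"
    and "finite_measure N" "vgroup m \<noteq> {}"
    and "\<And>n x. x \<in> vgroup m \<Longrightarrow> emeasure N (vint m n x) = emeasure N' (vint m n x)"
  shows "N = N'"
proof -
  obtain z where z: "z \<in> vgroup m" using assms by auto
  have z0: "vint m 0 z = vgroup m" by (auto simp: vint_def)
  show ?thesis
  proof (rule measure_eqI_generator_eq[where E = "vcyls m" and A = "\<lambda>_. vint m 0 z"])
    show "range (\<lambda>_. vint m 0 z) \<subseteq> vcyls m" using z by blast
    show "emeasure N (vint m 0 z) \<noteq> \<infinity>"
      using finite_measure.emeasure_finite[OF assms(3)] by auto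
  qed (use assms Int_stable_vcyls vcyls_Pow z0 in auto)
qed

context
  fixes m :: "nat \<Rightarrow> nat"
  assumes m2: "\<And>k. m k \<ge> 2"
begin

lemma m_pos: "0 < m k"
  using m2[of k] by simp

lemma prob_space_vprod: "prob_space (vprod m)"
  using m_pos by (intro prob_space_PiM prob_space_uniform_count_measure) auto

lemma zero_vgroup: "(\<lambda>_. 0) \<in> vgroup m"
  using m_pos by (auto simp: vgroup_def)

lemma emeasure_vprod_vint:
  assumes "x \<in> vgroup m"
  shows "emeasure (vprod m) (vint m n x) = (\<Prod>j<n. ennreal (1 / m j))"
proof -
  have "emeasure (vprod m) (vint m n x) =
      (\<Prod>j<n. emeasure (uniform_count_measure {..<m j}) ({..<m j} \<inter> {x j}))"
    unfolding vint_eq_emb using m_pos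
    by (intro emeasure_PiM_emb prob_space_uniform_count_measure)
       (auto simp: sets_uniform_count_measure)
  also have "\<dots> = (\<Prod>j<n. ennreal (1 / m j))"
  proof (rule prod.cong)
    fix j
    have "{..<m j} \<inter> {x j} = {x j}" using assms by (auto simp: vgroup_def)
    then show "emeasure (uniform_count_measure {..<m j}) ({..<m j} \<inter> {x j}) = ennreal (1 / m j)"
      using assms by (simp add: emeasure_uniform_count_measure vgroup_def)
  qed simp
  finally show ?thesis .
qed

lemma vadd_closed: "vadd m x y \<in> vgroup m"
  using m_pos by (auto simp: vadd_def vgroup_def)

lemma vadd_assoc: "vadd m x (vadd m y z) = vadd m (vadd m x y) z"
  by (auto simp: vadd_def mod_simps add.assoc)

lemma vadd_zero: "x \<in> vgroup m \<Longrightarrow> vadd m (\<lambda>_. 0) x = x"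
  by (auto simp: vadd_def vgroup_def)

lemma vadd_inverse:
  assumes "x \<in> vgroup m"
  obtains x' where "x' \<in> vgroup m" "vadd m x' x = (\<lambda>_. 0)" "vadd m x x' = (\<lambda>_. 0)"
proof
  let ?x' = "\<lambda>k. (m k - x k) mod m k"
  show "?x' \<in> vgroup m" using m_pos by (auto simp: vgroup_def)
  have "x k \<le> m k" for k using assms by (auto simp: vgroup_def less_imp_le)
  then show "vadd m ?x' x = (\<lambda>_. 0)" "vadd m x ?x' = (\<lambda>_. 0)"
    by (auto simp: vadd_def mod_simps)
qed

lemma vadd_image:
  assumes "x \<in> vgroup m" "x' \<in> vgroup m" "vadd m x' x = (\<lambda>_. 0)" "vadd m x x' = (\<lambda>_. 0)"
    and "A \<subseteq> vgroup m"
  shows "vadd m x ` A = {z \<in> vgroup m. vadd m x' z \<in> A}"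
proof (intro equalityI subsetI)
  fix z assume "z \<in> vadd m x ` A"
  then obtain a where "a \<in> A" "z = vadd m x a" by auto
  then show "z \<in> {z \<in> vgroup m. vadd m x' z \<in> A}"
    using assms vadd_closed by (auto simp: vadd_assoc vadd_zero subsetD)
next
  fix z assume "z \<in> {z \<in> vgroup m. vadd m x' z \<in> A}"
  then have "vadd m x' z \<in> A" "z = vadd m x (vadd m x' z)"
    using assms by (auto simp: vadd_assoc vadd_zero)
  then show "z \<in> vadd m x ` A" by blast
qed

lemma vadd_vimage_vint:
  assumes "x \<in> vgroup m" "x' \<in> vgroup m" "vadd m x' x = (\<lambda>_. 0)" "vadd m x x' = (\<lambda>_. 0)"
    and "y \<in> vgroup m"
  shows "{z \<in> vgroup m. vadd m x' z \<in> vint m n y} = vint m n (vadd m x y)"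
proof -
  have "vadd m x' z j = y j \<longleftrightarrow> z j = vadd m x y j" if z: "z \<in> vgroup m" for z j
  proof
    have 1: "z = vadd m x (vadd m x' z)" using assms z by (simp add: vadd_assoc vadd_zero)
    assume "vadd m x' z j = y j"
    then have "vadd m x (vadd m x' z) j = vadd m x y j" unfolding vadd_def[of m x] by simp
    with 1 show "z j = vadd m x y j" by metis
  next
    have 1: "y = vadd m x' (vadd m x y)" using assms by (simp add: vadd_assoc vadd_zero)
    assume "z j = vadd m x y j"
    then have "vadd m x' z j = vadd m x' (vadd m x y) j" unfolding vadd_def[of m x'] by simp
    with 1 show "vadd m x' z j = y j" by metis
  qed
  then show ?thesis using vadd_closed by (auto simp: vint_def)
qed

lemma vprod_is_haar_prob: "is_haar_prob m (vprod m)"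
  unfolding is_haar_prob_def
proof (intro conjI ballI)
  show "prob_space (vprod m)" by (rule prob_space_vprod)
  show "sets (vprod m) = sigma_sets (topspace (vtop m)) {U. openin (vtop m) U}"
    by (simp add: sets_vprod sigma_open_eq_vcyls)
  fix x A assume x: "x \<in> vgroup m" and A: "A \<in> sets (vprod m)"
  obtain x' where x': "x' \<in> vgroup m" "vadd m x' x = (\<lambda>_. 0)" "vadd m x x' = (\<lambda>_. 0)"
    using vadd_inverse[OF x] .
  note xx = x x'
  have vint_sets: "vint m n y \<in> sets (vprod m)" if "y \<in> vgroup m" for n y
    using that unfolding sets_vprod by auto
  have meas: "vadd m x' \<in> measurable (vprod m) (vprod m)"
  proof (rule measurable_sigma_sets[OF sets_vprod vcyls_Pow])
    show "vadd m x' \<in> space (vprod m) \<rightarrow> vgroup m" using vadd_closed by auto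
    fix C assume "C \<in> vcyls m"
    then show "vadd m x' -` C \<inter> space (vprod m) \<in> sets (vprod m)"
    proof
      assume "C \<in> {vint m n x |n x. x \<in> vgroup m}"
      then obtain n y where C: "C = vint m n y" "y \<in> vgroup m" by auto
      have "vadd m x' -` C \<inter> space (vprod m) = vint m n (vadd m x y)"
        using vadd_vimage_vint[OF xx C(2), of n] C by (auto simp: space_vprod)
      then show ?thesis using vint_sets vadd_closed by simp
    qed simp
  qed
  have eq: "vprod m = distr (vprod m) (vprod m) (vadd m x')"
  proof (rule eq_on_vcylsI)
    show "finite_measure (vprod m)"
      using prob_space_vprod by (rule prob_space.finite_measure)
    show "vgroup m \<noteq> {}" using x by auto
    fix n y assume y: "y \<in> vgroup m"
    have "vadd m x' -` vint m n y \<inter> space (vprod m) = vint m n (vadd m x y)"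
      using vadd_vimage_vint[OF xx y, of n] by (auto simp: space_vprod)
    then show "emeasure (vprod m) (vint m n y) =
        emeasure (distr (vprod m) (vprod m) (vadd m x')) (vint m n y)"
      using y vint_sets meas by (simp add: emeasure_distr emeasure_vprod_vint vadd_closed)
  qed (auto simp: sets_vprod)
  have "A \<subseteq> vgroup m" using sets.sets_into_space[OF A] by (simp add: space_vprod)
  then have "vadd m x ` A = vadd m x' -` A \<inter> space (vprod m)"
    using vadd_image[OF xx] by (auto simp: space_vprod)
  then have "emeasure (vprod m) (vadd m x ` A) =
      emeasure (distr (vprod m) (vprod m) (vadd m x')) A"
    using meas A by (simp add: emeasure_distr)
  with eq show "emeasure (vprod m) (vadd m x ` A) = emeasure (vprod m) A" by simp
qed

lemma is_haar_prob_vint: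
  assumes N: "is_haar_prob m N" and x: "x \<in> vgroup m"
  shows "emeasure N (vint m n x) * of_nat (card (vint m n ` vgroup m)) = 1"
proof -
  interpret prob_space N using N by (simp add: is_haar_prob_def)
  have sN: "sets N = sigma_sets (vgroup m) (vcyls m)"
    using N by (simp add: is_haar_prob_def sigma_open_eq_vcyls)
  have vint_sets: "vint m n y \<in> sets N" if "y \<in> vgroup m" for n y
    using that unfolding sN by auto
  have spN: "space N = vgroup m"
    using sN sets_eq_imp_space_eq[of N "vprod m"] by (simp add: sets_vprod space_vprod)
  have tr: "emeasure N (vint m n y) = emeasure N (vint m n (\<lambda>_. 0))" if y: "y \<in> vgroup m" for y
  proof -
    obtain y' where y': "y' \<in> vgroup m" "vadd m y' y = (\<lambda>_. 0)" "vadd m y y' = (\<lambda>_. 0)"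
      using vadd_inverse[OF y] .
    have "vadd m y (\<lambda>_. 0) = y" using y by (auto simp: vadd_def vgroup_def)
    then have "vadd m y ` vint m n (\<lambda>_. 0) = vint m n y"
      using vadd_image[OF y y' vint_subset] vadd_vimage_vint[OF y y' zero_vgroup, of n] by auto
    then show ?thesis
      using N y vint_sets[OF zero_vgroup, of n] unfolding is_haar_prob_def by metis
  qed
  have fin: "finite (vint m n ` vgroup m)"
  proof -
    have "vint m n ` vgroup m \<subseteq> (\<lambda>w. {y \<in> vgroup m. \<forall>j<n. y j = w j}) ` (\<Pi>\<^sub>E j\<in>{..<n}. {..<m j})"
    proof
      fix C assume "C \<in> vint m n ` vgroup m"
      then obtain y where y: "y \<in> vgroup m" "C = vint m n y" by auto
      then have "C = {z \<in> vgroup m. \<forall>j<n. z j = restrict y {..<n} j}" by (auto simp: vint_def)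
      moreover have "restrict y {..<n} \<in> (\<Pi>\<^sub>E j\<in>{..<n}. {..<m j})" using y by (auto simp: vgroup_def)
      ultimately show "C \<in> (\<lambda>w. {y \<in> vgroup m. \<forall>j<n. y j = w j}) ` (\<Pi>\<^sub>E j\<in>{..<n}. {..<m j})" by blast
    qed
    then show ?thesis by (rule finite_subset) (auto intro!: finite_PiE)
  qed
  have "disjoint_family_on (\<lambda>C. C) (vint m n ` vgroup m)"
    by (auto simp: disjoint_family_on_def vint_def)
  then have "(\<Sum>C\<in>vint m n ` vgroup m. emeasure N C) = emeasure N (\<Union>C\<in>vint m n ` vgroup m. C)"
    using vint_sets fin by (intro sum_emeasure) auto
  also have "(\<Union>C\<in>vint m n ` vgroup m. C) = space N"
    by (auto simp: spN vint_def)
  also have "emeasure N (space N) = 1" by (rule emeasure_space_1)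
  also have "(\<Sum>C\<in>vint m n ` vgroup m. emeasure N C) =
      (\<Sum>C\<in>vint m n ` vgroup m. emeasure N (vint m n x))"
    using tr x by (intro sum.cong) auto
  finally show ?thesis by (simp add: mult.commute)
qed

lemma is_haar_prob_unique:
  assumes N: "is_haar_prob m N" "is_haar_prob m N'"
  shows "N = N'"
proof (rule eq_on_vcylsI)
  show "sets N = sigma_sets (vgroup m) (vcyls m)" "sets N' = sigma_sets (vgroup m) (vcyls m)"
    using N by (simp_all add: is_haar_prob_def sigma_open_eq_vcyls)
  show "finite_measure N" using N by (simp add: is_haar_prob_def prob_space.finite_measure)
  show "vgroup m \<noteq> {}" using zero_vgroup by auto
  fix n x assume x: "x \<in> vgroup m"
  define c :: ennreal where "c = of_nat (card (vint m n ` vgroup m))"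
  have 1: "emeasure N (vint m n x) * c = 1" "emeasure N' (vint m n x) * c = 1"
    using is_haar_prob_vint[OF N(1) x, of n] is_haar_prob_vint[OF N(2) x, of n] by (simp_all add: c_def)
  have "emeasure N (vint m n x) = emeasure N (vint m n x) * (emeasure N' (vint m n x) * c)"
    using 1 by simp
  also have "\<dots> = emeasure N' (vint m n x) * (emeasure N (vint m n x) * c)"
    by (simp only: ac_simps)
  finally show "emeasure N (vint m n x) = emeasure N' (vint m n x)" using 1 by simp
qed

lemma haar_eq_PiM: "haar m = Pi\<^sub>M UNIV (\<lambda>k. uniform_count_measure {..<m k})"
  unfolding haar_def
  by (rule the_equality) (auto intro: vprod_is_haar_prob is_haar_prob_unique)

lemma haar_is_haar_prob: "is_haar_prob m (haar m)"
  unfolding haar_eq_PiM by (rule vprod_is_haar_prob)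

end

end

theory Submission
  imports Defs
begin

text \<open>
  a) For \<open>M\<^sub>n \<le> k < M\<^bsub>n+1\<^esub>\<close> the maximal function of \<open>S\<^sub>k f - f\<close> is at most that of
  \<open>S\<^bsub>M\<^sub>n\<^esub> f - f\<close> plus \<open>|S\<^sub>k g|\<close>, where \<open>g = S\<^bsub>M\<^sub>n\<^sub>+\<^sub>1\<^esub> f - S\<^bsub>M\<^sub>n\<^esub> f\<close>. By its mixed-radix expansion
  \<open>{..<k}\<close> splits into at most \<open>(n + 1) * sup m\<close> blocks \<open>{a..<a + M\<^sub>j}\<close> with \<open>M\<^sub>j\<close> dividing \<open>a\<close>.
  The projection to such a block is \<open>S\<^bsub>M\<^sub>j\<^esub>\<close> conjugated by the unimodular \<open>\<psi>\<^sub>a\<close>, hence an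
  \<open>L\<^sub>1\<close> contraction, so that \<open>\<parallel>S\<^sub>k f - f\<parallel> = O(n) * \<omega>(1 / M\<^sub>n, f)\<close>.

  b) Take \<open>f = (\<Sum>l. (1 / M\<^sub>l) \<psi>\<^bsub>M\<^sub>s\<^esub> D\<^bsub>M\<^sub>s\<^esub>)\<close> with \<open>s = 2 M\<^sub>l\<close>. Each \<open>D\<^bsub>M\<^sub>s\<^esub>\<close> has \<open>L\<^sub>1\<close> norm 1, so the
  modulus of continuity is a geometrically decaying tail. For \<open>q = M\<^sub>0 + M\<^sub>2 + \<dots> + M\<^bsub>2(N-1)\<^esub>\<close>
  the norm of \<open>D\<^sub>q\<close> is at least \<open>N / 3\<close>, and with \<open>N = M\<^sub>l\<close> stopping at \<open>k = M\<^sub>s + q\<close> leaves an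
  \<open>L\<^sub>1\<close> error of at least \<open>(M\<^sub>l / 3 - 1) / M\<^sub>l\<close>.
\<close>

section \<open>Vilenkin polynomials and the data of the counterexample\<close>

definition vpoly :: "(nat \<Rightarrow> nat) \<Rightarrow> (nat \<Rightarrow> complex) \<Rightarrow> nat set \<Rightarrow> (nat \<Rightarrow> nat) \<Rightarrow> complex" where
  "vpoly m c A x = (\<Sum>k\<in>A. c k * vilenkin m k x)"

text \<open>The factor \<open>1 / vM m l\<close> attached to level \<open>s = 2 * vM m l\<close>,
  written as \<open>2 / s\<close> so that no \<open>l\<close> has to be chosen.\<close>

definition gap_weight :: "(nat \<Rightarrow> nat) \<Rightarrow> nat \<Rightarrow> real" where
  "gap_weight m s = (if \<exists>l. s = 2 * vM m l then 2 / real s else 0)"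

text \<open>At most one summand is nonzero: the coefficients on \<open>{M\<^sub>s..<2 * M\<^sub>s}\<close> are \<open>gap_weight m s\<close>.\<close>

definition gap_coeff :: "(nat \<Rightarrow> nat) \<Rightarrow> nat \<Rightarrow> complex" where
  "gap_coeff m k = (\<Sum>s\<le>k. if vM m s \<le> k \<and> k < 2 * vM m s then of_real (gap_weight m s) else 0)"

definition even_sum :: "(nat \<Rightarrow> nat) \<Rightarrow> nat \<Rightarrow> nat" where
  "even_sum m N = (\<Sum>j<N. vM m (2 * j))"

abbreviation dirichlet :: "(nat \<Rightarrow> nat) \<Rightarrow> nat \<Rightarrow> (nat \<Rightarrow> nat) \<Rightarrow> complex" where
  "dirichlet m n \<equiv> vpoly m (\<lambda>_. 1) {..<n}"

text \<open>Partial sums, tails and blocks all become \<open>vpoly\<close> with one coefficient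
  sequence and varying index sets, so that splitting a sum is splitting a set.\<close>

lemma psum_eq_vpoly: "psum m n g = vpoly m (fcoeff m g) {..<n}"
  by (simp add: fun_eq_iff psum_def vpoly_def)

lemma mart_psum_eq_vpoly: "mart_psum m n f = vpoly m (mart_fcoeff m f) {..<n}"
  by (simp add: fun_eq_iff mart_psum_def vpoly_def)

lemma vM_dvd: "i \<le> j \<Longrightarrow> vM m i dvd vM m j"
  unfolding vM_def by (rule prod_dvd_prod_subset) auto

lemma gap_weight_nonneg: "0 \<le> gap_weight m s"
  by (simp add: gap_weight_def)

lemma gap_weight_vM: "gap_weight m (2 * vM m l) = 1 / real (vM m l)"
  by (auto simp: gap_weight_def)

lemma norm_rademacher [simp]: "norm (rademacher m k x) = 1"
  by (simp add: rademacher_def norm_exp_eq_Re)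

lemma norm_vilenkin [simp]: "norm (vilenkin m n x) = 1"
  by (simp add: vilenkin_def norm_power flip: prod_norm)

lemma vilenkin_cnj [simp]: "vilenkin m k x * cnj (vilenkin m k x) = 1"
  by (simp add: complex_norm_square[symmetric])

lemma norm_vpoly_le: "norm (vpoly m c A x) \<le> (\<Sum>k\<in>A. norm (c k))"
  unfolding vpoly_def by (rule order_trans[OF norm_sum]) (simp add: norm_mult)

lemma vpoly_Un_disjoint:
  assumes "finite A" "finite B" "A \<inter> B = {}"
  shows "vpoly m c (A \<union> B) x = vpoly m c A x + vpoly m c B x"
  unfolding vpoly_def by (rule sum.union_disjoint[OF assms])

lemma vpoly_ivl_add:
  assumes "i \<le> j" "j \<le> k"
  shows "vpoly m c {i..<j} x + vpoly m c {j..<k} x = vpoly m c {i..<k} x"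
  unfolding vpoly_def by (rule sum.atLeastLessThan_concat[OF assms])

lemma nn_integral_le_H1_norm: "(\<integral>\<^sup>+ x. norm (f n x) \<partial>haar m) \<le> H1_norm m f"
  unfolding H1_norm_def vmaximal_def by (intro nn_integral_mono SUP_upper) simp

text \<open>Evaluates the \<open>lim\<close> in \<open>mart_fcoeff\<close>, whose sequence is
  eventually constant.\<close>

lemma lim_eq_of_le:
  fixes a :: "nat \<Rightarrow> complex"
  assumes "\<And>k. n \<le> k \<Longrightarrow> a k = l"
  shows "lim a = l"
  using assms by (intro limI tendsto_eventually eventually_sequentiallyI)

lemma norm_dirichlet_le: "norm (dirichlet m n x) \<le> n"
  using norm_vpoly_le[of m "\<lambda>_. 1" "{..<n}" x] by simp

section \<open>Characters and their orthogonality\<close>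

context
  fixes m :: "nat \<Rightarrow> nat"
  assumes m2: "\<And>k. m k \<ge> 2"
begin

lemma vdigit_eq_0:
  assumes "n < vM m N" "N \<le> k"
  shows "vdigit m n k = 0"
proof -
  have "n < vM m k"
    using assms vM_mono[of m N k, OF m2] by linarith
  then show ?thesis
    by (simp add: vdigit_def)
qed

text \<open>There are no carries: \<open>a\<close> has nonzero digits only at positions from
  \<open>j\<close> on, \<open>l\<close> only at positions below \<open>j\<close>.\<close>

lemma vdigit_add:
  assumes "vM m j dvd a" "l < vM m j"
  shows "vdigit m (a + l) i = vdigit m a i + vdigit m l i"
proof (cases "i < j")
  case True
  have pos: "vM m i > 0"
    using m2 by (rule vM_pos)
  have "vM m (Suc i) dvd a"
    using True vM_dvd[of "Suc i" j m] assms(1) dvd_trans by fastforce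
  then obtain d where "a = vM m (Suc i) * d"
    by (rule dvdE)
  then have a: "a = vM m i * (m i * d)"
    by (simp only: vM_Suc ac_simps)
  have "(a + l) div vM m i = m i * d + l div vM m i"
    using pos unfolding a by simp
  moreover have "a div vM m i = m i * d"
    using pos unfolding a by simp
  ultimately show ?thesis
    by (simp add: vdigit_def)
next
  case False
  then obtain d where d: "vM m i = vM m j * d"
    using vM_dvd[of j i m] by (auto elim: dvdE)
  obtain b where b: "a = vM m j * b"
    using assms(1) by (rule dvdE)
  have "(a + l) div vM m i = a div vM m i"
    using assms(2) unfolding d b by (simp add: div_mult2_eq)
  moreover have "vdigit m l i = 0"
    using False assms(2) by (intro vdigit_eq_0[of l j]) auto
  ultimately show ?thesis
    by (simp add: vdigit_def)
qed

text \<open>A common range of factors lets characters with different indices be compared factor by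
  factor.\<close>

lemma vilenkin_eq_prod:
  assumes "n < vM m N"
  shows "vilenkin m n x = (\<Prod>k<N. rademacher m k x ^ vdigit m n k)"
  unfolding vilenkin_def
proof (rule prod.mono_neutral_left)
  show "{k. vdigit m n k \<noteq> 0} \<subseteq> {..<N}"
    using vdigit_eq_0[OF assms] by (metis (mono_tags) lessThan_iff mem_Collect_eq not_less subsetI)
qed auto

lemma vilenkin_add:
  assumes "vM m j dvd a" "l < vM m j"
  shows "vilenkin m (a + l) x = vilenkin m a x * vilenkin m l x"
proof -
  \<comment> \<open>The range \<open>a + l\<close> is long enough for all three characters, because
    \<open>n < vM m n\<close>.\<close>
  have N: "a + l < vM m (a + l)"
    using m2 by (rule vM_gt)
  then show ?thesis
    by (subst (1 2 3) vilenkin_eq_prod[of _ "a + l"])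
       (simp_all add: vdigit_add[OF assms] power_add prod.distrib)
qed

lemma vilenkin_mult_vM:
  assumes "q < m j"
  shows "vilenkin m (q * vM m j) x = rademacher m j x ^ q"
proof -
  have pos: "vM m j > 0"
    using m2 by (rule vM_pos)
  have less: "q * vM m j < vM m (Suc j)"
    using assms pos by simp
  have "vdigit m (q * vM m j) k = (if k = j then q else 0)" if "k < Suc j" for k
    using vdigit_unique[where m = m and N = "Suc j" and a = "\<lambda>k. if k = j then q else 0" and i = k]
      m2 that assms m_pos[of m, OF m2] by (auto simp: if_distrib[of "\<lambda>a. a * _"] cong: if_cong)
  then have "vilenkin m (q * vM m j) x = (\<Prod>k<Suc j. if k = j then rademacher m j x ^ q else 1)"
    unfolding vilenkin_eq_prod[OF less] by (intro prod.cong) auto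
  then show ?thesis
    by simp
qed

lemma rademacher_power_m: "rademacher m k x ^ m k = 1"
proof -
  have "rademacher m k x ^ m k = exp (2 * of_real pi * \<i> * of_nat (x k))"
    using m2[of k] by (simp add: rademacher_def flip: exp_of_nat_mult)
  also have "\<dots> = exp (2 * of_int (int (x k)) * of_real pi * \<i>)"
    by (simp add: mult_ac)
  also have "\<dots> = 1"
    by (subst exp_eq_1) (auto intro: exI[of _ "int (x k)"])
  finally show ?thesis .
qed

lemma rademacher_eq_iff:
  assumes "x k < m k" "y k < m k"
  shows "rademacher m k x = rademacher m k y \<longleftrightarrow> x k = y k"
  using complex_root_unity_eq[of "m k" "x k" "y k"] m2[of k] assms
  by (auto simp: rademacher_def cong_def mult_ac)

text \<open>A full geometric sum in the \<open>m k\<close>-th root of unity \<open>z\<close>, the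
  quotient of the two Rademacher values.\<close>

lemma sum_rademacher_powers:
  assumes "x \<in> vgroup m" "y \<in> vgroup m"
  shows "(\<Sum>q<m k. rademacher m k x ^ q * cnj (rademacher m k y ^ q)) = (if x k = y k then of_nat (m k) else 0)"
proof -
  have cnj: "rademacher m k y * cnj (rademacher m k y) = 1"
    by (simp add: complex_norm_square[symmetric])
  define z where "z = rademacher m k x * cnj (rademacher m k y)"
  have eq: "(\<Sum>q<m k. rademacher m k x ^ q * cnj (rademacher m k y ^ q)) = (\<Sum>q<m k. z ^ q)"
    by (simp add: z_def power_mult_distrib)
  have z_iff: "z = 1 \<longleftrightarrow> x k = y k"
  proof -
    have "rademacher m k x = z * rademacher m k y"
      using cnj by (simp add: z_def ac_simps)
    moreover have "rademacher m k y \<noteq> 0"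
      using cnj by auto
    ultimately have "z = 1 \<longleftrightarrow> rademacher m k x = rademacher m k y"
      by auto
    then show ?thesis
      using assms rademacher_eq_iff[of x k y] by (simp add: vgroup_def)
  qed
  have "z ^ m k = 1"
    by (simp add: z_def power_mult_distrib rademacher_power_m flip: complex_cnj_power)
  then have "(\<Sum>q<m k. z ^ q) = 0" if "z \<noteq> 1"
    using that geometric_sum[of z "m k"] by simp
  then show ?thesis
    unfolding eq using z_iff by auto
qed

text \<open>This is the Dirichlet kernel of order \<open>vM m j\<close> at the difference of
  \<open>x\<close> and \<open>y\<close>. Separating the top digit \<open>q\<close> of the index
  factors the sum into a geometric sum and the kernel of the previous level.\<close>

lemma vilenkin_kernel:
  assumes "x \<in> vgroup m" "y \<in> vgroup m"
  shows "(\<Sum>l<vM m j. vilenkin m l x * cnj (vilenkin m l y)) = (if \<forall>i<j. x i = y i then of_nat (vM m j) else 0)"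
proof (induction j)
  case 0
  show ?case
    by (simp add: vilenkin_eq_prod[of 0 0])
next
  case (Suc j)
  let ?h = "\<lambda>l. vilenkin m l x * cnj (vilenkin m l y)"
  have "(\<Sum>l<vM m (Suc j). ?h l) = (\<Sum>q<m j. \<Sum>l\<in>{q * vM m j..<q * vM m j + vM m j}. ?h l)"
    unfolding vM_Suc by (rule sum.nat_group[symmetric])
  also have "\<dots> = (\<Sum>q<m j. \<Sum>l<vM m j. ?h (q * vM m j + l))"
  proof (rule sum.cong[OF refl])
    fix q
    show "(\<Sum>l\<in>{q * vM m j..<q * vM m j + vM m j}. ?h l) = (\<Sum>l<vM m j. ?h (q * vM m j + l))"
      using sum.shift_bounds_nat_ivl[of ?h 0 "q * vM m j" "vM m j"] by (simp add: lessThan_atLeast0 add.commute)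
  qed
  also have "\<dots> = (\<Sum>q<m j. \<Sum>l<vM m j. (rademacher m j x ^ q * cnj (rademacher m j y ^ q)) * ?h l)"
    by (intro sum.cong refl) (simp add: vilenkin_add[of j] vilenkin_mult_vM)
  also have "\<dots> = (\<Sum>q<m j. rademacher m j x ^ q * cnj (rademacher m j y ^ q)) * (\<Sum>l<vM m j. ?h l)"
    by (rule sum_product[symmetric])
  also have "\<dots> = (if \<forall>i<Suc j. x i = y i then of_nat (vM m (Suc j)) else 0)"
    unfolding Suc sum_rademacher_powers[OF assms] by (auto simp: less_Suc_eq)
  finally show ?case .
qed

section \<open>Measurability and integrability on the group\<close>

lemma sets_haar: "sets (haar m) = sigma_sets (vgroup m) (vcyls m)"
  by (simp add: haar_eq_PiM[OF m2] sets_vprod)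

lemma space_haar [simp]: "space (haar m) = vgroup m"
  by (simp add: haar_eq_PiM[OF m2] space_vprod)

lemma prob_space_haar: "prob_space (haar m)"
  using haar_is_haar_prob[of m, OF m2] by (simp add: is_haar_prob_def)

lemma vint_sets [measurable]: "x \<in> vgroup m \<Longrightarrow> vint m n x \<in> sets (haar m)"
  unfolding sets_haar by auto

lemma emeasure_haar_vint:
  assumes "x \<in> vgroup m"
  shows "emeasure (haar m) (vint m n x) = ennreal (1 / vM m n)"
proof -
  have "emeasure (haar m) (vint m n x) = (\<Prod>j<n. ennreal (1 / m j))"
    unfolding haar_eq_PiM[OF m2] by (rule emeasure_vprod_vint[of m, OF m2 assms])
  also have "\<dots> = ennreal (\<Prod>j<n. 1 / real (m j))"
    by (rule prod_ennreal) auto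
  finally show ?thesis
    by (simp add: vM_def prod_dividef)
qed

text \<open>A preimage is the union of the intervals of level \<open>n\<close> that meet it, and
  there are only countably many intervals.\<close>

lemma vint_const_vimage:
  assumes "\<And>x y. x \<in> vgroup m \<Longrightarrow> y \<in> vint m n x \<Longrightarrow> g y = g x"
  shows "g -` B \<inter> vgroup m \<in> sigma_sets (vgroup m) (vint m n ` vgroup m)"
proof -
  have "g -` B \<inter> vgroup m = \<Union>(vint m n ` (g -` B \<inter> vgroup m))"
    using assms by (auto simp: vint_def)
  also have "\<dots> \<in> sigma_sets (vgroup m) (vint m n ` vgroup m)"
  proof (rule sigma_sets_UNION)
    show "countable (vint m n ` (g -` B \<inter> vgroup m))"
      by (rule countable_subset[OF _ countable_vcyls[of m]]) auto
  qed (auto intro: sigma_sets.Basic)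
  finally show ?thesis .
qed

lemma measurable_vsigmaI:
  fixes g :: "_ \<Rightarrow> complex"
  assumes "\<And>x y. x \<in> vgroup m \<Longrightarrow> y \<in> vint m n x \<Longrightarrow> g y = g x"
  shows "g \<in> borel_measurable (vsigma m n)"
proof -
  have sub: "vint m n ` vgroup m \<subseteq> Pow (vgroup m)"
    using vint_subset by auto
  show ?thesis
    by (rule measurableI)
       (use vint_const_vimage[OF assms] sub in \<open>auto simp: vsigma_def\<close>)
qed

lemma measurable_haarI:
  fixes g :: "_ \<Rightarrow> complex"
  assumes "\<And>x y. x \<in> vgroup m \<Longrightarrow> y \<in> vint m n x \<Longrightarrow> g y = g x"
  shows "g \<in> borel_measurable (haar m)"
proof -
  have "sigma_sets (vgroup m) (vint m n ` vgroup m) \<subseteq> sets (haar m)"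
    unfolding sets_haar by (rule sigma_sets_mono') auto
  then show ?thesis
    using vint_const_vimage[of n g, OF assms] by (intro measurableI) auto
qed

lemma vilenkin_vint:
  assumes "k < vM m n" "y \<in> vint m n x"
  shows "vilenkin m k y = vilenkin m k x"
  unfolding vilenkin_eq_prod[OF assms(1)]
  using assms(2) by (intro prod.cong) (auto simp: rademacher_def vint_def)

lemma measurable_vilenkin [measurable]: "vilenkin m k \<in> borel_measurable (haar m)"
  by (rule measurable_haarI[where n = k], rule vilenkin_vint) (rule vM_gt[OF m2])

lemma measurable_cnj_vilenkin [measurable]: "(\<lambda>x. cnj (vilenkin m k x)) \<in> borel_measurable (haar m)"
  by (rule borel_measurable_continuous_on[OF _ measurable_vilenkin]) (intro continuous_intros)

lemma measurable_vpoly [measurable]: "vpoly m c A \<in> borel_measurable (haar m)"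
  unfolding vpoly_def by measurable

lemma integrable_vpoly: "integrable (haar m) (vpoly m c A)"
proof -
  interpret prob_space "haar m" by (rule prob_space_haar)
  show ?thesis
    by (rule integrable_const_bound[where B = "\<Sum>k\<in>A. norm (c k)"]) (auto intro: norm_vpoly_le)
qed

lemma integrable_mult_cnj_vilenkin:
  assumes "integrable (haar m) g"
  shows "integrable (haar m) (\<lambda>x. g x * cnj (vilenkin m k x))"
proof -
  have [measurable]: "g \<in> borel_measurable (haar m)"
    using assms by auto
  show ?thesis
    by (rule Bochner_Integration.integrable_bound[OF assms]) (auto simp: norm_mult)
qed

section \<open>Translation invariance and orthonormality of the characters\<close>

lemma distr_haar_vadd:
  assumes y: "y \<in> vgroup m"
  shows "vadd m y \<in> measurable (haar m) (haar m)" "distr (haar m) (haar m) (vadd m y) = haar m"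
proof -
  show meas: "vadd m y \<in> measurable (haar m) (haar m)"
    unfolding haar_eq_PiM[OF m2] vadd_def
  proof (rule measurable_PiM_single')
    fix i
    have "(\<lambda>a. (y i + a) mod m i) \<in> measurable (uniform_count_measure {..<m i}) (uniform_count_measure {..<m i})"
      using m_pos[of m, OF m2]
      by (auto simp: measurable_def space_uniform_count_measure sets_uniform_count_measure)
    then show "(\<lambda>x. (y i + x i) mod m i) \<in> measurable (vprod m) (uniform_count_measure {..<m i})"
      by (rule measurable_compose[rotated]) simp
  qed (use m_pos[of m, OF m2] in \<open>auto simp: space_uniform_count_measure\<close>)
  show "distr (haar m) (haar m) (vadd m y) = haar m"
  proof (rule measure_eqI)
    fix A assume "A \<in> sets (distr (haar m) (haar m) (vadd m y))"
    then have A: "A \<in> sets (haar m)" by simp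
    then have sub: "A \<subseteq> vgroup m"
      using sets.sets_into_space by fastforce
    obtain y' where y': "y' \<in> vgroup m" "vadd m y' y = (\<lambda>_. 0)" "vadd m y y' = (\<lambda>_. 0)"
      using vadd_inverse[of m, OF m2 y] .
    \<comment> \<open>Invariance is given for images, whereas \<open>distr\<close> needs preimages;
      the inverse element \<open>y'\<close> turns one into the other.\<close>
    have "vadd m y' ` A = vadd m y -` A \<inter> space (haar m)"
      using vadd_image[of m, OF m2 y'(1) y y'(3,2) sub] by auto
    then have "emeasure (distr (haar m) (haar m) (vadd m y)) A = emeasure (haar m) (vadd m y' ` A)"
      using meas A by (simp add: emeasure_distr)
    also have "\<dots> = emeasure (haar m) A"
      using haar_is_haar_prob[of m, OF m2] y'(1) A by (simp add: is_haar_prob_def)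
    finally show "emeasure (distr (haar m) (haar m) (vadd m y)) A = emeasure (haar m) A" .
  qed simp
qed

lemma integral_haar_vadd:
  fixes g :: "_ \<Rightarrow> complex"
  assumes "y \<in> vgroup m" "g \<in> borel_measurable (haar m)"
  shows "(LINT x|haar m. g (vadd m y x)) = (LINT x|haar m. g x)"
  using integral_distr[OF distr_haar_vadd(1)[OF assms(1)] assms(2)]
  by (simp add: distr_haar_vadd(2)[OF assms(1)])

lemma rademacher_vadd: "rademacher m k (vadd m y x) = rademacher m k y * rademacher m k x"
proof -
  have "rademacher m k y * rademacher m k x = exp (2 * of_real pi * \<i> * of_nat (y k + x k) / of_nat (m k))"
    by (simp add: rademacher_def exp_add[symmetric] ring_distribs add_divide_distrib)
  also have "\<dots> = rademacher m k (vadd m y x)"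
    using complex_root_unity_eq[of "m k" "y k + x k" "(y k + x k) mod m k"] m2[of k]
    by (auto simp: rademacher_def vadd_def cong_def mult_ac)
  finally show ?thesis by simp
qed

lemma vilenkin_vadd: "vilenkin m k (vadd m y x) = vilenkin m k y * vilenkin m k x"
  by (simp add: vilenkin_def rademacher_vadd power_mult_distrib prod.distrib)

text \<open>Evaluation at the unit vector \<open>e\<close> of coordinate \<open>i\<close> isolates
  the \<open>i\<close>-th digit of the index.\<close>

lemma vilenkin_inj:
  assumes "\<And>x. x \<in> vgroup m \<Longrightarrow> vilenkin m k x = vilenkin m l x"
  shows "k = l"
proof -
  define N where "N = k + l"
  have N: "k < vM m N" "l < vM m N"
    using vM_gt[of m N, OF m2] by (auto simp: N_def)
  have "vdigit m k i = vdigit m l i" if i: "i < N" for i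
  proof -
    define e :: "nat \<Rightarrow> nat" where "e = (\<lambda>j. if j = i then 1 else 0)"
    have e: "e \<in> vgroup m"
      unfolding e_def vgroup_def using m2 m_pos[of m, OF m2] by (auto simp: Suc_le_eq numeral_2_eq_2)
    \<comment> \<open>Written as a Rademacher value at a constant point, the power reveals its
      exponent through \<open>rademacher_eq_iff\<close>.\<close>
    have val: "vilenkin m n e = rademacher m i (\<lambda>_. vdigit m n i)" if "n < vM m N" for n
    proof -
      have "vilenkin m n e = (\<Prod>j<N. if j = i then rademacher m i e ^ vdigit m n i else 1)"
        unfolding vilenkin_eq_prod[OF that] by (intro prod.cong) (auto simp: e_def rademacher_def)
      also have "\<dots> = rademacher m i e ^ vdigit m n i"
        using i by simp
      also have "\<dots> = rademacher m i (\<lambda>_. vdigit m n i)"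
        by (simp add: e_def rademacher_def mult_ac flip: exp_of_nat_mult)
      finally show ?thesis .
    qed
    have "rademacher m i (\<lambda>_. vdigit m k i) = rademacher m i (\<lambda>_. vdigit m l i)"
      using val[OF N(1)] val[OF N(2)] assms[OF e] by simp
    then show ?thesis
      using rademacher_eq_iff[of "\<lambda>_. vdigit m k i" i "\<lambda>_. vdigit m l i"] vdigit_less[of m, OF m2] by simp
  qed
  then show ?thesis
    using vdigit_sum[OF N(1)] vdigit_sum[OF N(2)] by simp
qed

text \<open>For distinct characters, translation by a point \<open>y\<close> where they differ
  multiplies the integral by some \<open>z \<noteq> 1\<close> and yet preserves it, so it
  vanishes.\<close>

lemma vilenkin_orthonormal:
  "(LINT x|haar m. vilenkin m k x * cnj (vilenkin m l x)) = (if k = l then 1 else 0)"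
proof (cases "k = l")
  case True
  interpret prob_space "haar m" by (rule prob_space_haar)
  show ?thesis
    using True prob_space by simp
next
  case False
  then obtain y where y: "y \<in> vgroup m" "vilenkin m k y \<noteq> vilenkin m l y"
    using vilenkin_inj by blast
  define z where "z = vilenkin m k y * cnj (vilenkin m l y)"
  have "z * vilenkin m l y = vilenkin m k y"
    by (simp add: z_def mult.assoc) (simp add: mult.commute)
  then have z: "z \<noteq> 1"
    using y by auto
  let ?I = "LINT x|haar m. vilenkin m k x * cnj (vilenkin m l x)"
  have "?I = (LINT x|haar m. vilenkin m k (vadd m y x) * cnj (vilenkin m l (vadd m y x)))"
    by (rule integral_haar_vadd[symmetric, OF y(1)]) measurable
  also have "\<dots> = (LINT x|haar m. z * (vilenkin m k x * cnj (vilenkin m l x)))"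
    by (simp add: vilenkin_vadd z_def ac_simps)
  also have "\<dots> = z * ?I"
    by simp
  finally show ?thesis
    using z False by simp
qed

lemma fcoeff_cong:
  assumes "\<And>x. x \<in> vgroup m \<Longrightarrow> g x = h x"
  shows "fcoeff m g k = fcoeff m h k"
  unfolding fcoeff_def using assms by (intro Bochner_Integration.integral_cong) auto

lemma fcoeff_vpoly:
  assumes "finite A"
  shows "fcoeff m (vpoly m c A) i = (if i \<in> A then c i else 0)"
proof -
  have int: "integrable (haar m) (\<lambda>x. c k * vilenkin m k x * cnj (vilenkin m i x))" for k
    using integrable_mult_cnj_vilenkin[OF integrable_vpoly[of c "{k}"], of i] by (simp add: vpoly_def)
  have "fcoeff m (vpoly m c A) i = (LINT x|haar m. (\<Sum>k\<in>A. c k * vilenkin m k x * cnj (vilenkin m i x)))"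
    by (simp add: fcoeff_def vpoly_def sum_distrib_right)
  also have "\<dots> = (\<Sum>k\<in>A. (LINT x|haar m. c k * vilenkin m k x * cnj (vilenkin m i x)))"
    by (rule Bochner_Integration.integral_sum) (rule int)
  also have "\<dots> = (\<Sum>k\<in>A. if k = i then c i else 0)"
    by (intro sum.cong) (auto simp: mult.assoc vilenkin_orthonormal)
  finally show ?thesis
    using assms by simp
qed

lemma psum_vpoly:
  assumes "finite A"
  shows "psum m n (vpoly m c A) = vpoly m c ({..<n} \<inter> A)"
proof
  fix x
  have "psum m n (vpoly m c A) x = (\<Sum>k<n. if k \<in> A then c k * vilenkin m k x else 0)"
    by (auto simp: psum_def fcoeff_vpoly[OF assms] intro: sum.cong)
  then show "psum m n (vpoly m c A) x = vpoly m c ({..<n} \<inter> A) x"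
    by (simp add: vpoly_def sum.inter_restrict)
qed

section \<open>Partial sums in \<open>L\<^sub>1\<close> and in \<open>H\<^sub>1\<close>\<close>

text \<open>The kernel equals \<open>vM m j\<close> on an interval of measure
  \<open>1 / vM m j\<close> and vanishes elsewhere.\<close>

lemma nn_integral_kernel:
  assumes y: "y \<in> vgroup m"
  shows "(\<integral>\<^sup>+ x. norm (\<Sum>l<vM m j. vilenkin m l x * cnj (vilenkin m l y)) \<partial>haar m) = 1"
proof -
  have "(\<integral>\<^sup>+ x. norm (\<Sum>l<vM m j. vilenkin m l x * cnj (vilenkin m l y)) \<partial>haar m) =
      (\<integral>\<^sup>+ x. ennreal (vM m j) * indicator (vint m j y) x \<partial>haar m)"
    using y by (intro nn_integral_cong) (auto simp: vilenkin_kernel vint_def)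
  also have "\<dots> = ennreal (vM m j) * ennreal (1 / vM m j)"
    using y vint_sets[OF y] by (simp add: nn_integral_cmult_indicator emeasure_haar_vint)
  also have "\<dots> = 1"
    using vM_pos[of m j, OF m2] by (simp add: ennreal_mult[symmetric] del: ennreal_of_nat_eq_real_of_nat)
  finally show ?thesis .
qed

text \<open>\<open>psum m (vM m j)\<close> is integration against the nonnegative kernel of \<open>vilenkin_kernel\<close>, of mass 1.\<close>

lemma nn_integral_psum_vM_le:
  assumes g: "integrable (haar m) g"
  shows "(\<integral>\<^sup>+ x. norm (psum m (vM m j) g x) \<partial>haar m) \<le> (\<integral>\<^sup>+ x. norm (g x) \<partial>haar m)"
proof -
  interpret prob_space "haar m" by (rule prob_space_haar)
  interpret P: pair_sigma_finite "haar m" "haar m" ..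
  have [measurable]: "g \<in> borel_measurable (haar m)"
    using g by auto
  define K where "K = (\<lambda>x y. \<Sum>l<vM m j. vilenkin m l x * cnj (vilenkin m l y))"
  have psum: "psum m (vM m j) g x = (LINT y|haar m. g y * K x y)" for x
  proof -
    have int: "integrable (haar m) (\<lambda>y. (g y * cnj (vilenkin m l y)) * vilenkin m l x)" for l
      using integrable_mult_cnj_vilenkin[OF g] by simp
    have "(LINT y|haar m. g y * K x y) =
        (LINT y|haar m. (\<Sum>l<vM m j. (g y * cnj (vilenkin m l y)) * vilenkin m l x))"
      by (simp add: K_def sum_distrib_left mult_ac)
    also have "\<dots> = (\<Sum>l<vM m j. (LINT y|haar m. (g y * cnj (vilenkin m l y)) * vilenkin m l x))"
      by (rule Bochner_Integration.integral_sum) (rule int)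
    finally show ?thesis
      by (simp add: psum_def fcoeff_def)
  qed
  have [measurable]: "case_prod K \<in> borel_measurable (haar m \<Otimes>\<^sub>M haar m)"
    unfolding K_def by measurable
  have "(\<integral>\<^sup>+ x. norm (psum m (vM m j) g x) \<partial>haar m) \<le> (\<integral>\<^sup>+ x. \<integral>\<^sup>+ y. norm (g y * K x y) \<partial>haar m \<partial>haar m)"
  proof (rule nn_integral_mono)
    fix x
    have "integrable (haar m) (\<lambda>y. g y * K x y)"
      using integrable_mult_cnj_vilenkin[OF g]
      by (auto simp: K_def sum_distrib_left mult.left_commute[of "g _"])
    then show "ennreal (norm (psum m (vM m j) g x)) \<le> (\<integral>\<^sup>+ y. norm (g y * K x y) \<partial>haar m)"
      unfolding psum by (rule integral_norm_bound_ennreal)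
  qed
  \<comment> \<open>Integrating over \<open>x\<close> first leaves the kernel mass, which is 1 for
    every \<open>y\<close>.\<close>
  also have "\<dots> = (\<integral>\<^sup>+ y. \<integral>\<^sup>+ x. norm (g y * K x y) \<partial>haar m \<partial>haar m)"
    by (rule P.Fubini'[symmetric]) measurable
  also have "\<dots> = (\<integral>\<^sup>+ y. norm (g y) * (\<integral>\<^sup>+ x. norm (K x y) \<partial>haar m) \<partial>haar m)"
    by (intro nn_integral_cong) (simp add: norm_mult ennreal_mult nn_integral_cmult)
  also have "\<dots> = (\<integral>\<^sup>+ y. norm (g y) \<partial>haar m)"
    by (intro nn_integral_cong) (simp add: nn_integral_kernel K_def)
  finally show ?thesis .
qed

lemma vpoly_block:
  assumes "vM m j dvd a" "k \<le> vM m j"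
  shows "vpoly m c {a..<a + k} x = vilenkin m a x * vpoly m (\<lambda>l. c (a + l)) {..<k} x"
proof -
  have "vpoly m c {a..<a + k} x = (\<Sum>l<k. c (a + l) * vilenkin m (a + l) x)"
    using sum.shift_bounds_nat_ivl[of "\<lambda>l. c l * vilenkin m l x" 0 a "k"]
    by (simp add: vpoly_def lessThan_atLeast0 add.commute)
  also have "\<dots> = (\<Sum>l<k. vilenkin m a x * (c (a + l) * vilenkin m l x))"
    by (intro sum.cong) (use assms(2) in \<open>simp_all add: vilenkin_add[OF assms(1)]\<close>)
  finally show ?thesis
    by (simp add: vpoly_def sum_distrib_left)
qed

text \<open>Multiplication by \<open>cnj (vilenkin m a)\<close> moves frequency \<open>a + l\<close>
  to \<open>l\<close> and leaves the modulus unchanged, which reduces the block to an initial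
  partial sum of order \<open>vM m j\<close>.\<close>

lemma nn_integral_block_le:
  assumes g: "integrable (haar m) g" and a: "vM m j dvd a"
  shows "(\<integral>\<^sup>+ x. norm (vpoly m (fcoeff m g) {a..<a + vM m j} x) \<partial>haar m) \<le> (\<integral>\<^sup>+ x. norm (g x) \<partial>haar m)"
proof -
  let ?h = "\<lambda>x. g x * cnj (vilenkin m a x)"
  have h: "integrable (haar m) ?h"
    by (rule integrable_mult_cnj_vilenkin[OF g])
  have coeff: "fcoeff m g (a + l) = fcoeff m ?h l" if "l < vM m j" for l
    by (simp add: fcoeff_def vilenkin_add[OF a that] mult.assoc)
  have "vpoly m (\<lambda>l. fcoeff m g (a + l)) {..<vM m j} = psum m (vM m j) ?h"
    by (auto simp: fun_eq_iff vpoly_def psum_def coeff)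
  then have "norm (vpoly m (fcoeff m g) {a..<a + vM m j} x) = norm (psum m (vM m j) ?h x)" for x
    by (simp add: vpoly_block[OF a order_refl] norm_mult)
  then show ?thesis
    using nn_integral_psum_vM_le[OF h, of j] by (simp add: norm_mult)
qed

lemma nn_integral_vpoly_ivl_le:
  assumes "i \<le> j" "j \<le> k"
  shows "(\<integral>\<^sup>+ x. norm (vpoly m c {i..<k} x) \<partial>haar m) \<le>
    (\<integral>\<^sup>+ x. norm (vpoly m c {i..<j} x) \<partial>haar m) + (\<integral>\<^sup>+ x. norm (vpoly m c {j..<k} x) \<partial>haar m)"
proof -
  have "(\<integral>\<^sup>+ x. norm (vpoly m c {i..<k} x) \<partial>haar m) \<le>
    (\<integral>\<^sup>+ x. ennreal (norm (vpoly m c {i..<j} x)) + ennreal (norm (vpoly m c {j..<k} x)) \<partial>haar m)"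
    unfolding vpoly_ivl_add[OF assms, symmetric]
    by (intro nn_integral_mono) (simp add: norm_triangle_ineq flip: ennreal_plus)
  then show ?thesis
    by (simp add: nn_integral_add)
qed

lemma nn_integral_blocks_le:
  assumes g: "integrable (haar m) g" and a: "vM m j dvd a"
  shows "(\<integral>\<^sup>+ x. norm (vpoly m (fcoeff m g) {a..<a + q * vM m j} x) \<partial>haar m) \<le>
    of_nat q * (\<integral>\<^sup>+ x. norm (g x) \<partial>haar m)"
proof (induction q)
  case 0
  then show ?case by (simp add: vpoly_def)
next
  case (Suc q)
  have "(\<integral>\<^sup>+ x. norm (vpoly m (fcoeff m g) {a..<a + Suc q * vM m j} x) \<partial>haar m) \<le>
    (\<integral>\<^sup>+ x. norm (vpoly m (fcoeff m g) {a..<a + q * vM m j} x) \<partial>haar m) +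
    (\<integral>\<^sup>+ x. norm (vpoly m (fcoeff m g) {a + q * vM m j..<a + q * vM m j + vM m j} x) \<partial>haar m)"
    using nn_integral_vpoly_ivl_le[of a "a + q * vM m j" "a + Suc q * vM m j" "fcoeff m g"] by (simp add: ac_simps)
  also have "\<dots> \<le> of_nat q * (\<integral>\<^sup>+ x. norm (g x) \<partial>haar m) + (\<integral>\<^sup>+ x. norm (g x) \<partial>haar m)"
    using a by (intro add_mono Suc nn_integral_block_le g) auto
  finally show ?case
    by (simp add: ring_distribs add.commute)
qed

text \<open>Each induction step peels off the top digit \<open>q\<close> of \<open>k\<close>:
  \<open>q\<close> full blocks cost at most \<open>L\<close> norms of \<open>g\<close>. The offset
  \<open>a\<close> varies because the rest starts at \<open>a + q * vM m N\<close>, again a multiple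
  of \<open>vM m N\<close>.\<close>

lemma nn_integral_partial_sum_le:
  assumes g: "integrable (haar m) g" and bound: "\<And>k. m k \<le> L"
    and a: "vM m N dvd a" and k: "k < vM m N"
  shows "(\<integral>\<^sup>+ x. norm (vpoly m (fcoeff m g) {a..<a + k} x) \<partial>haar m) \<le>
    of_nat (L * N) * (\<integral>\<^sup>+ x. norm (g x) \<partial>haar m)"
  using a k
proof (induction N arbitrary: a k)
  case 0
  then show ?case by (simp add: vpoly_def)
next
  case (Suc N)
  define q r where "q = k div vM m N" and "r = k mod vM m N"
  have pos: "vM m N > 0"
    using m2 by (rule vM_pos)
  have k: "k = q * vM m N + r"
    unfolding q_def r_def by (rule div_mult_mod_eq[symmetric])
  have r: "r < vM m N"
    using pos by (simp add: r_def)
  have "q < m N"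
    using Suc.prems(2) unfolding q_def by (simp add: less_mult_imp_div_less)
  then have q: "q \<le> L"
    using bound[of N] by linarith
  have a: "vM m N dvd a"
    by (rule dvd_trans[OF vM_dvd Suc.prems(1)]) simp
  let ?I = "\<integral>\<^sup>+ x. norm (g x) \<partial>haar m"
  have "(\<integral>\<^sup>+ x. norm (vpoly m (fcoeff m g) {a..<a + k} x) \<partial>haar m) \<le>
    (\<integral>\<^sup>+ x. norm (vpoly m (fcoeff m g) {a..<a + q * vM m N} x) \<partial>haar m) +
    (\<integral>\<^sup>+ x. norm (vpoly m (fcoeff m g) {a + q * vM m N..<(a + q * vM m N) + r} x) \<partial>haar m)"
    using nn_integral_vpoly_ivl_le[of a "a + q * vM m N" "a + k" "fcoeff m g"] by (simp add: k ac_simps)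
  also have "\<dots> \<le> of_nat q * ?I + of_nat (L * N) * ?I"
    using a r by (intro add_mono nn_integral_blocks_le g Suc.IH) auto
  also have "\<dots> \<le> of_nat L * ?I + of_nat (L * N) * ?I"
    using q by (intro add_mono mult_right_mono) auto
  also have "\<dots> = of_nat (L * Suc N) * ?I"
    by (simp add: ring_distribs)
  finally show ?case .
qed

section \<open>Martingales and their remainders as polynomials\<close>

lemma is_vmart_eq_vpoly:
  assumes f: "is_vmart m f" and x: "x \<in> vgroup m"
  shows "f n x = vpoly m (mart_fcoeff m f) {..<vM m n} x"
proof -
  have f_eq: "f n x = vpoly m (fcoeff m (f k)) {..<vM m n} x" if "n \<le> k" "x \<in> vgroup m" for n k x
    using f that by (simp add: is_vmart_def psum_eq_vpoly)
  \<comment> \<open>From level \<open>n\<close> on, the coefficients below \<open>vM m n\<close> no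
    longer change, so the \<open>lim\<close> in \<open>mart_fcoeff\<close> is attained at level
    \<open>n\<close>.\<close>
  have coeff: "fcoeff m (f k) i = fcoeff m (f n) i" if "n \<le> k" "i < vM m n" for i k
    using fcoeff_cong[of "f n" "vpoly m (fcoeff m (f k)) {..<vM m n}" i, OF f_eq] that
    by (simp add: fcoeff_vpoly)
  have "mart_fcoeff m f i = fcoeff m (f n) i" if "i < vM m n" for i
    unfolding mart_fcoeff_def by (rule lim_eq_of_le[of n]) (rule coeff[OF _ that])
  then show ?thesis
    using f_eq[of n n] x by (auto simp: vpoly_def)
qed

text \<open>Any coefficient sequence defines a martingale, because partial sums only truncate
  polynomials. The counterexample is built this way.\<close>

lemma is_vmart_vpoly: "is_vmart m (\<lambda>n. vpoly m c {..<vM m n})"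
  unfolding is_vmart_def
proof (intro conjI allI impI ballI)
  fix n k :: nat and x
  show "integrable (haar m) (vpoly m c {..<vM m n})"
    by (rule integrable_vpoly)
  show "vpoly m c {..<vM m n} \<in> borel_measurable (vsigma m n)"
    by (rule measurable_vsigmaI) (auto simp: vpoly_def vilenkin_vint)
  assume "n \<le> k"
  then have "{..<vM m n} \<inter> {..<vM m k} = {..<vM m n}"
    using vM_mono[of m n k, OF m2] by auto
  then show "psum m (vM m n) (vpoly m c {..<vM m k}) x = vpoly m c {..<vM m n} x"
    by (simp add: psum_vpoly)
qed

lemma mart_fcoeff_vpoly: "mart_fcoeff m (\<lambda>n. vpoly m c {..<vM m n}) i = c i"
  unfolding mart_fcoeff_def
proof (rule lim_eq_of_le)
  fix k assume "i \<le> k"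
  then have "i < vM m k"
    using vM_gt[of m k, OF m2] by linarith
  then show "fcoeff m (vpoly m c {..<vM m k}) i = c i"
    by (simp add: fcoeff_vpoly)
qed

text \<open>At level \<open>j\<close> the martingale of \<open>mart_psum m k f\<close> keeps the
  frequencies below both \<open>k\<close> and \<open>vM m j\<close>. Both signs of the difference
  occur: one in the convergence claims, the other in \<open>omega_H1\<close>.\<close>

lemma norm_mart_diff_psum:
  assumes "is_vmart m f" "x \<in> vgroup m"
  shows "norm (mart_diff (mart_of m (mart_psum m k f)) f j x) = norm (vpoly m (mart_fcoeff m f) {k..<vM m j} x)"
    and "norm (mart_diff f (mart_of m (mart_psum m k f)) j x) = norm (vpoly m (mart_fcoeff m f) {k..<vM m j} x)"
proof -
  let ?c = "mart_fcoeff m f"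
  have split: "{..<vM m j} = ({..<vM m j} \<inter> {..<k}) \<union> {k..<vM m j}"
    by auto
  have "f j x = vpoly m ?c ({..<vM m j} \<inter> {..<k}) x + vpoly m ?c {k..<vM m j} x"
    unfolding is_vmart_eq_vpoly[OF assms, of j]
    by (subst split, rule vpoly_Un_disjoint) auto
  moreover have "mart_of m (mart_psum m k f) j x = vpoly m ?c ({..<vM m j} \<inter> {..<k}) x"
    by (simp add: mart_of_def mart_psum_eq_vpoly psum_vpoly)
  ultimately show "norm (mart_diff (mart_of m (mart_psum m k f)) f j x) = norm (vpoly m ?c {k..<vM m j} x)"
    "norm (mart_diff f (mart_of m (mart_psum m k f)) j x) = norm (vpoly m ?c {k..<vM m j} x)"
    by (simp_all add: mart_diff_def)
qed

lemma H1_norm_mart_diff_psum: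
  assumes "is_vmart m f"
  shows "H1_norm m (mart_diff (mart_of m (mart_psum m k f)) f) =
      H1_norm m (\<lambda>j. vpoly m (mart_fcoeff m f) {k..<vM m j})"
    and "H1_norm m (mart_diff f (mart_of m (mart_psum m k f))) =
      H1_norm m (\<lambda>j. vpoly m (mart_fcoeff m f) {k..<vM m j})"
  unfolding H1_norm_def vmaximal_def
  using norm_mart_diff_psum[OF assms] by (auto intro!: nn_integral_cong)

text \<open>The maximal function of \<open>f - S\<^sub>k f\<close> exceeds that of \<open>f - S\<^bsub>M\<^sub>n\<^esub> f\<close> by at most \<open>|S\<^sub>k (f - S\<^bsub>M\<^sub>n\<^esub> f)|\<close>.\<close>

lemma H1_norm_remainder_le:
  assumes bound: "\<And>i. m i \<le> L" and k: "vM m n \<le> k" "k < vM m (Suc n)"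
  shows "H1_norm m (\<lambda>j. vpoly m c {k..<vM m j}) \<le>
    of_nat (L * Suc n + 1) * H1_norm m (\<lambda>j. vpoly m c {vM m n..<vM m j})"
proof -
  let ?R = "\<lambda>j. vpoly m c {vM m n..<vM m j}"
  let ?P = "vpoly m c {vM m n..<k}"
  have [measurable]: "vmaximal ?R \<in> borel_measurable (haar m)"
    unfolding vmaximal_def by measurable
  have pointwise: "vmaximal (\<lambda>j. vpoly m c {k..<vM m j}) x \<le> ennreal (norm (?P x)) + vmaximal ?R x" for x
    unfolding vmaximal_def
  proof (rule SUP_least)
    fix j
    show "ennreal (norm (vpoly m c {k..<vM m j} x)) \<le>
      ennreal (norm (?P x)) + (SUP j. ennreal (norm (?R j x)))"
    proof (cases "j \<le> n")
      case True
      then have "vM m j \<le> k"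
        using vM_mono[of m j n, OF m2] k by simp
      then show ?thesis
        by (simp add: vpoly_def)
    next
      case False
      then have "k \<le> vM m j"
        using vM_mono[of m "Suc n" j, OF m2] k by simp
      then have "?R j x = ?P x + vpoly m c {k..<vM m j} x"
        using vpoly_ivl_add k(1) by simp
      then have "norm (vpoly m c {k..<vM m j} x) \<le> norm (?P x) + norm (?R j x)"
        by (metis add_diff_cancel_left' add.commute norm_triangle_ineq4)
      then have "ennreal (norm (vpoly m c {k..<vM m j} x)) \<le> ennreal (norm (?P x)) + ennreal (norm (?R j x))"
        by (simp flip: ennreal_plus)
      also have "\<dots> \<le> ennreal (norm (?P x)) + (SUP j. ennreal (norm (?R j x)))"
        by (intro add_left_mono SUP_upper) simp
      finally show ?thesis .
    qed
  qed
  \<comment> \<open>The coefficients of \<open>?R (Suc n)\<close> vanish below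
    \<open>vM m n\<close>, so \<open>?P\<close> is its partial sum of order \<open>k\<close>; the
    form \<open>{0..<0 + k}\<close> fits the block estimate with offset 0.\<close>
  have "?P = vpoly m (fcoeff m (?R (Suc n))) {0..<0 + k}"
  proof
    fix x
    have "{0..<k} = {0..<vM m n} \<union> {vM m n..<k}"
      using k by auto
    then show "?P x = vpoly m (fcoeff m (?R (Suc n))) {0..<0 + k} x"
      using k by (simp add: vpoly_Un_disjoint)
        (auto simp: vpoly_def fcoeff_vpoly intro!: sum.cong)
  qed
  then have "(\<integral>\<^sup>+ x. norm (?P x) \<partial>haar m) \<le> of_nat (L * Suc n) * (\<integral>\<^sup>+ x. norm (?R (Suc n) x) \<partial>haar m)"
    using nn_integral_partial_sum_le[OF integrable_vpoly bound, of "Suc n" 0 k c "{vM m n..<vM m (Suc n)}"] k(2)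
    by simp
  also have "\<dots> \<le> of_nat (L * Suc n) * H1_norm m ?R"
    by (intro mult_left_mono nn_integral_le_H1_norm) simp
  finally have P: "(\<integral>\<^sup>+ x. norm (?P x) \<partial>haar m) \<le> of_nat (L * Suc n) * H1_norm m ?R" .
  have "H1_norm m (\<lambda>j. vpoly m c {k..<vM m j}) \<le> (\<integral>\<^sup>+ x. ennreal (norm (?P x)) + vmaximal ?R x \<partial>haar m)"
    unfolding H1_norm_def by (intro nn_integral_mono pointwise)
  also have "\<dots> = (\<integral>\<^sup>+ x. norm (?P x) \<partial>haar m) + H1_norm m ?R"
    by (simp add: nn_integral_add H1_norm_def)
  also have "\<dots> \<le> of_nat (L * Suc n) * H1_norm m ?R + H1_norm m ?R"
    using P by (rule add_right_mono)
  also have "\<dots> = of_nat (L * Suc n + 1) * H1_norm m ?R"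
    by (simp only: of_nat_add of_nat_1 ring_distribs mult_1)
  finally show ?thesis .
qed

lemma vM_bracket:
  assumes "0 < k"
  obtains n where "vM m n \<le> k" "k < vM m (Suc n)"
proof -
  define n where "n = (LEAST n. k < vM m (Suc n))"
  have ex: "k < vM m (Suc k)"
    using vM_gt[of m "Suc k", OF m2] by simp
  then have "k < vM m (Suc n)"
    unfolding n_def by (rule LeastI)
  moreover have "vM m n \<le> k"
  proof (cases n)
    case (Suc i)
    then show ?thesis
      using not_less_Least[of i "\<lambda>n. k < vM m (Suc n)"] by (simp add: n_def)
  qed (use assms in simp)
  ultimately show ?thesis
    using that by blast
qed

section \<open>Convergence in the Hardy norm\<close>

lemma psum_tendsto_H1:
  assumes f: "is_vmart m f" and bdd: "bdd_above (range m)"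
    and omega: "\<And>c. c > 0 \<Longrightarrow> \<forall>\<^sub>F n in sequentially. omega_H1 m n f \<le> ennreal (c * (1 / real n))"
  shows "(\<lambda>k. H1_norm m (mart_diff (mart_of m (mart_psum m k f)) f)) \<longlonglongrightarrow> 0"
proof (rule order_tendstoI)
  let ?R = "\<lambda>k. H1_norm m (\<lambda>j. vpoly m (mart_fcoeff m f) {k..<vM m j})"
  obtain L where L: "m i \<le> L" for i
    using bdd by (auto simp: bdd_above_def)
  fix e :: ennreal assume "0 < e"
  \<comment> \<open>A real bound is needed, while \<open>e\<close> may be infinite.\<close>
  then obtain e' where e': "0 < ennreal e'" "ennreal e' < e"
    by (metis dense ennreal_cases less_top_ennreal not_less_iff_gr_or_eq order_less_trans top_greatest linorder_not_less)
  \<comment> \<open>Chosen so that the factor \<open>L * Suc n + 1\<close>, at most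
    \<open>(2 * L + 1) * n\<close> for \<open>n \<ge> 1\<close>, is absorbed by
    \<open>c / n\<close>.\<close>
  define c where "c = e' / real (2 * L + 1)"
  have c: "c > 0"
    using e' by (simp add: c_def)
  obtain n0 where n0: "omega_H1 m n f \<le> ennreal (c * (1 / real n))" if "n \<ge> n0" for n
    using omega[OF c] by (auto simp: eventually_sequentially)
  \<comment> \<open>The threshold \<open>vM m (Suc n0)\<close> forces the level \<open>n\<close> of
    \<open>k\<close> to exceed \<open>n0\<close>; in particular \<open>n \<ge> 1\<close>.\<close>
  have "?R k < e" if k: "k \<ge> vM m (Suc n0)" for k
  proof -
    have "0 < k"
      using k vM_pos[of m "Suc n0", OF m2] by linarith
    then obtain n where n: "vM m n \<le> k" "k < vM m (Suc n)"
      by (rule vM_bracket)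
    have "n0 < n"
    proof (rule ccontr)
      assume "\<not> n0 < n"
      then have "vM m (Suc n) \<le> vM m (Suc n0)"
        using m2 by (intro vM_mono) auto
      then show False
        using k n by linarith
    qed
    have "?R k \<le> of_nat (L * Suc n + 1) * ?R (vM m n)"
      by (rule H1_norm_remainder_le[OF L n])
    also have "?R (vM m n) = omega_H1 m n f"
      unfolding omega_H1_def by (rule H1_norm_mart_diff_psum(2)[OF f, symmetric])
    also have "of_nat (L * Suc n + 1) * omega_H1 m n f \<le> of_nat (L * Suc n + 1) * ennreal (c * (1 / real n))"
      using \<open>n0 < n\<close> by (intro mult_left_mono n0) auto
    also have "\<dots> = ennreal (real (L * Suc n + 1) * (c * (1 / real n)))"
      using c by (simp only: ennreal_of_nat_eq_real_of_nat, subst ennreal_mult) auto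
    also have "\<dots> \<le> ennreal e'"
    proof (rule ennreal_leI)
      have "L + 1 \<le> L * n + n"
        using \<open>n0 < n\<close> by (intro add_mono) auto
      then have "L * Suc n + 1 \<le> (2 * L + 1) * n"
        by (simp add: ring_distribs)
      then have "real (L * Suc n + 1) \<le> real ((2 * L + 1) * n)"
        by (simp only: of_nat_le_iff)
      then have "real (L * Suc n + 1) * (c * (1 / real n)) \<le> real ((2 * L + 1) * n) * (c * (1 / real n))"
        using c by (intro mult_right_mono) auto
      also have "\<dots> = e'"
      proof -
        have "W * d * (e' / W * (1 / d)) = e'" if "W \<noteq> 0" "d \<noteq> 0" for W d :: real
          using that by simp
        from this[of "real (2 * L + 1)" "real n"] show ?thesis
          using \<open>n0 < n\<close> by (simp only: c_def of_nat_mult[of "2 * L + 1"])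
      qed
      finally show "real (L * Suc n + 1) * (c * (1 / real n)) \<le> e'" .
    qed
    finally show ?thesis
      using e'(2) by simp
  qed
  then show "\<forall>\<^sub>F k in sequentially. H1_norm m (mart_diff (mart_of m (mart_psum m k f)) f) < e"
    unfolding H1_norm_mart_diff_psum(1)[OF f] by (auto simp: eventually_sequentially)
qed simp

section \<open>A lacunary martingale with divergent partial sums\<close>

declare vM_Suc [simp del]

text \<open>This growth keeps the intervals \<open>{vM m s..<2 * vM m s}\<close> disjoint and makes
  the weights decay geometrically.\<close>

lemma double_vM_le: "2 * vM m s \<le> vM m (Suc s)"
  using m2[of s] by (simp add: vM_Suc mult_right_mono)

lemma gap_coeff_eq:
  assumes "vM m s \<le> k" "k < vM m (Suc s)"
  shows "gap_coeff m k = (if k < 2 * vM m s then of_real (gap_weight m s) else 0)"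
proof -
  have "t = s" if t: "vM m t \<le> k" "k < 2 * vM m t" for t
  proof -
    have "k < vM m (Suc t)"
      using t(2) double_vM_le[of t] by linarith
    moreover have "vM m (Suc s) \<le> vM m t" if "s < t"
      using m2 that by (intro vM_mono) auto
    moreover have "vM m (Suc t) \<le> vM m s" if "t < s"
      using m2 that by (intro vM_mono) auto
    ultimately show ?thesis
      using t(1) assms by (cases s t rule: linorder_cases) auto
  qed
  then have "vM m t \<le> k \<and> k < 2 * vM m t \<longleftrightarrow> t = s \<and> k < 2 * vM m s" for t
    using assms(1) by blast
  then have "gap_coeff m k = (\<Sum>t\<le>k. if t = s then (if k < 2 * vM m s then of_real (gap_weight m s) else 0) else 0)"
    unfolding gap_coeff_def by (intro sum.cong) auto
  \<comment> \<open>The sum in \<open>gap_coeff\<close> stops at \<open>k\<close>, so it has to be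
    checked that the one relevant index is reached.\<close>
  moreover have "s \<le> k"
    using assms vM_gt[of m s, OF m2] by linarith
  ultimately show ?thesis
    by simp
qed

text \<open>Within one level the coefficients are constant up to \<open>2 * vM m s\<close> and then
  zero, which leaves a multiple of a piece of a Dirichlet kernel.\<close>

lemma gap_vpoly_eq:
  assumes "vM m s \<le> i" "j \<le> vM m (Suc s)"
  shows "vpoly m (gap_coeff m) {i..<j} x =
    of_real (gap_weight m s) * vpoly m (\<lambda>_. 1) ({i..<j} \<inter> {..<2 * vM m s}) x"
proof -
  have "vpoly m (gap_coeff m) {i..<j} x =
      (\<Sum>k\<in>{i..<j}. if k \<in> {..<2 * vM m s} then of_real (gap_weight m s) * vilenkin m k x else 0)"
    unfolding vpoly_def using assms by (intro sum.cong) (auto simp: gap_coeff_eq[of s])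
  also have "\<dots> = (\<Sum>k\<in>{i..<j} \<inter> {..<2 * vM m s}. of_real (gap_weight m s) * vilenkin m k x)"
    by (rule sum.inter_restrict[symmetric]) simp
  finally show ?thesis
    by (simp add: vpoly_def sum_distrib_left)
qed

section \<open>Upper bounds for the remainders of the lacunary series\<close>

lemma norm_dirichlet_shift:
  assumes "q \<le> vM m s"
  shows "norm (vpoly m (\<lambda>_. 1) {vM m s..<vM m s + q} x) = norm (dirichlet m q x)"
  by (simp add: vpoly_block[OF dvd_refl assms] norm_mult)

text \<open>The kernel formula at \<open>y = 0\<close>, where every character is 1.\<close>

lemma dirichlet_vM:
  assumes "x \<in> vgroup m"
  shows "dirichlet m (vM m j) x = (if \<forall>i<j. x i = 0 then of_nat (vM m j) else 0)"
  using vilenkin_kernel[OF assms zero_vgroup[of m, OF m2], of j]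
  by (simp add: vpoly_def vilenkin_def rademacher_def)

lemma nn_integral_dirichlet_vM: "(\<integral>\<^sup>+ x. norm (dirichlet m (vM m j) x) \<partial>haar m) = 1"
  using nn_integral_kernel[OF zero_vgroup[of m, OF m2], of j]
  by (simp add: vpoly_def vilenkin_def[of m _ "\<lambda>_. 0"] rademacher_def)

lemma norm_gap_block_le:
  "norm (vpoly m (gap_coeff m) {vM m s..<vM m (Suc s)} x) = gap_weight m s * norm (dirichlet m (vM m s) x)"
proof -
  have "{vM m s..<vM m (Suc s)} \<inter> {..<2 * vM m s} = {vM m s..<vM m s + vM m s}"
    using double_vM_le[of s] by auto
  then show ?thesis
    using gap_vpoly_eq[of s "vM m s" "vM m (Suc s)" x] gap_weight_nonneg[of m s]
    by (simp add: norm_mult norm_dirichlet_shift)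
qed

lemma norm_gap_remainder_le:
  "norm (vpoly m (gap_coeff m) {vM m n..<vM m (n + i)} x) \<le>
    (\<Sum>s<i. gap_weight m (n + s) * norm (dirichlet m (vM m (n + s)) x))"
proof (induction i)
  case 0
  then show ?case by (simp add: vpoly_def)
next
  case (Suc i)
  have "vpoly m (gap_coeff m) {vM m n..<vM m (n + Suc i)} x =
    vpoly m (gap_coeff m) {vM m n..<vM m (n + i)} x + vpoly m (gap_coeff m) {vM m (n + i)..<vM m (Suc (n + i))} x"
    using vM_mono[of m n "n + i", OF m2] vM_mono[of m "n + i" "Suc (n + i)", OF m2]
    by (subst vpoly_ivl_add) simp_all
  then have "norm (vpoly m (gap_coeff m) {vM m n..<vM m (n + Suc i)} x) \<le>
    norm (vpoly m (gap_coeff m) {vM m n..<vM m (n + i)} x) + gap_weight m (n + i) * norm (dirichlet m (vM m (n + i)) x)"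
    using norm_triangle_ineq by (metis norm_gap_block_le)
  with Suc show ?case
    by simp
qed

text \<open>The maximal function is dominated by the weighted series of the
  \<open>norm (dirichlet m (vM m s) x)\<close>. Each of these has integral 1, so only the sum of the
  weights remains.\<close>

lemma H1_norm_gap_remainder_le:
  assumes bound: "\<And>i. (\<Sum>s<i. gap_weight m (n + s)) \<le> E"
  shows "H1_norm m (\<lambda>j. vpoly m (gap_coeff m) {vM m n..<vM m j}) \<le> ennreal E"
proof -
  let ?g = "\<lambda>s x. ennreal (gap_weight m (n + s)) * ennreal (norm (dirichlet m (vM m (n + s)) x))"
  have "vmaximal (\<lambda>j. vpoly m (gap_coeff m) {vM m n..<vM m j}) x \<le> (\<Sum>s. ?g s x)" for x
    unfolding vmaximal_def
  proof (rule SUP_least)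
    fix j
    show "ennreal (norm (vpoly m (gap_coeff m) {vM m n..<vM m j} x)) \<le> (\<Sum>s. ?g s x)"
    proof (cases "n \<le> j")
      case True
      then obtain i where j: "j = n + i"
        using le_iff_add by blast
      have "ennreal (norm (vpoly m (gap_coeff m) {vM m n..<vM m j} x)) \<le>
        ennreal (\<Sum>s<i. gap_weight m (n + s) * norm (dirichlet m (vM m (n + s)) x))"
        unfolding j by (intro ennreal_leI norm_gap_remainder_le)
      also have "\<dots> = (\<Sum>s<i. ?g s x)"
        by (subst sum_ennreal[symmetric]) (auto simp: gap_weight_nonneg ennreal_mult)
      also have "\<dots> \<le> (\<Sum>s. ?g s x)"
        by (rule sum_le_suminf) auto
      finally show ?thesis .
    next
      case False
      then have "vM m j \<le> vM m n"
        using m2 by (intro vM_mono) auto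
      then show ?thesis
        by (simp add: vpoly_def)
    qed
  qed
  then have "H1_norm m (\<lambda>j. vpoly m (gap_coeff m) {vM m n..<vM m j}) \<le> (\<integral>\<^sup>+ x. (\<Sum>s. ?g s x) \<partial>haar m)"
    unfolding H1_norm_def by (intro nn_integral_mono)
  also have "\<dots> = (\<Sum>s. \<integral>\<^sup>+ x. ?g s x \<partial>haar m)"
    by (rule nn_integral_suminf) measurable
  also have "\<dots> = (\<Sum>s. ennreal (gap_weight m (n + s)))"
    by (simp add: nn_integral_cmult nn_integral_dirichlet_vM)
  also have "\<dots> \<le> ennreal E"
  proof (rule suminf_le_const)
    fix i
    show "(\<Sum>s<i. ennreal (gap_weight m (n + s))) \<le> ennreal E"
      by (subst sum_ennreal) (auto simp: gap_weight_nonneg intro: ennreal_leI bound)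
  qed simp
  finally show ?thesis .
qed

text \<open>The subtracted term makes the induction telescope, since
  \<open>1 / M \<le> 2 / M - 2 / M'\<close> whenever \<open>M' \<ge> 2 * M > 0\<close>.\<close>

lemma sum_inverse_vM_le: "(\<Sum>l\<in>{n..<n + i}. 1 / real (vM m l)) \<le> 2 / real (vM m n) - 2 / real (vM m (n + i))"
proof (induction i)
  case (Suc i)
  have pos: "vM m (n + i) > 0"
    using m2 by (rule vM_pos)
  have "2 * real (vM m (n + i)) \<le> real (vM m (n + Suc i))"
    using double_vM_le[of "n + i"] by (metis add_Suc_right of_nat_le_iff of_nat_mult of_nat_numeral)
  then have "2 / real (vM m (n + Suc i)) \<le> 2 / (2 * real (vM m (n + i)))"
    using pos by (intro divide_left_mono) auto
  with Suc show ?case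
    by simp
qed simp

text \<open>Only the indices \<open>2 * vM m l\<close> with \<open>l \<ge> n\<close> contribute;
  reindexing by \<open>l\<close> gives a geometrically dominated sum.\<close>

lemma sum_gap_weight_le:
  assumes fin: "finite S" and S: "\<And>l. 2 * vM m l \<in> S \<Longrightarrow> n \<le> l"
  shows "(\<Sum>s\<in>S. gap_weight m s) \<le> 2 / real (vM m n)"
proof -
  obtain J where J: "S \<subseteq> {..<J}"
    using fin finite_nat_set_iff_bounded by auto
  \<comment> \<open>Any \<open>2 * vM m l\<close> in \<open>S\<close> has
    \<open>l < vM m l < J\<close>, so this range of \<open>l\<close> covers all nonzero
    weights.\<close>
  let ?T = "(\<lambda>l. 2 * vM m l) ` {n..<n + J}"
  have inj: "inj (\<lambda>l. 2 * vM m l)"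
  proof (rule strict_mono_imp_inj_on, rule strict_monoI_Suc)
    fix l
    show "2 * vM m l < 2 * vM m (Suc l)"
      using double_vM_le[of l] vM_pos[of m l, OF m2] by linarith
  qed
  have sub: "s \<in> ?T" if s: "s \<in> S" "gap_weight m s \<noteq> 0" for s
  proof -
    obtain l where l: "s = 2 * vM m l"
      using s by (auto simp: gap_weight_def split: if_splits)
    have "l < J"
      using s l J vM_gt[of m l, OF m2] by fastforce
    then show ?thesis
      using S[of l] s l by auto
  qed
  have "(\<Sum>s\<in>S. gap_weight m s) = (\<Sum>s\<in>{s\<in>S. gap_weight m s \<noteq> 0}. gap_weight m s)"
    using fin by (intro sum.mono_neutral_right) auto
  also have "\<dots> \<le> (\<Sum>s\<in>?T. gap_weight m s)"
    using sub by (intro sum_mono2) (auto simp: gap_weight_nonneg)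
  also have "\<dots> = (\<Sum>l\<in>{n..<n + J}. 1 / real (vM m l))"
    using inj by (subst sum.reindex) (auto simp: gap_weight_vM intro: inj_on_subset)
  also have "\<dots> \<le> 2 / real (vM m n)"
    using sum_inverse_vM_le[of n J] by (rule order_trans) simp
  finally show ?thesis .
qed

lemma sum_gap_weight_shift_le:
  assumes "\<And>l. N \<le> 2 * vM m l \<Longrightarrow> n \<le> l"
  shows "(\<Sum>s<i. gap_weight m (N + s)) \<le> 2 / real (vM m n)"
proof -
  have "(\<Sum>s<i. gap_weight m (N + s)) = (\<Sum>s\<in>{N..<N + i}. gap_weight m s)"
    using sum.shift_bounds_nat_ivl[of "gap_weight m" 0 N i] by (simp add: lessThan_atLeast0 add.commute)
  also have "\<dots> \<le> 2 / real (vM m n)"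
    using assms by (intro sum_gap_weight_le) auto
  finally show ?thesis .
qed

section \<open>Lower bounds for Dirichlet kernels\<close>

lemma even_sum_le: "3 * even_sum m N \<le> vM m (2 * N)"
proof (induction N)
  case (Suc N)
  \<comment> \<open>The new term adds \<open>3 * vM m (2 * N)\<close>, and two doublings make room
    for the resulting factor 4.\<close>
  have "3 * even_sum m (Suc N) \<le> 4 * vM m (2 * N)"
    using Suc by (simp add: even_sum_def)
  also have "\<dots> \<le> vM m (2 * Suc N)"
    using double_vM_le[of "2 * N"] double_vM_le[of "Suc (2 * N)"] by simp
  finally show ?case .
qed (simp add: even_sum_def)

text \<open>
  On \<open>vint m (2 * j) 0 - vint m (2 * j + 1) 0\<close> the term \<open>D\<^bsub>M\<^sub>2\<^sub>j\<^esub> = M\<^sub>2\<^sub>j\<close> dominates: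
  the larger ones vanish and the smaller ones add up to at most \<open>M\<^sub>2\<^sub>j / 3\<close>.
\<close>

lemma norm_dirichlet_even_sum_ge:
  assumes x: "x \<in> vgroup m"
  shows "(\<Sum>j<N. 2 / 3 * real (vM m (2 * j)) * indicator {x. (\<forall>i<2 * j. x i = 0) \<and> x (2 * j) \<noteq> 0} x)
    \<le> norm (dirichlet m (even_sum m N) x)"
proof (induction N)
  case (Suc N)
  let ?B = "\<lambda>j. {x. (\<forall>i<2 * j. x i = (0::nat)) \<and> x (2 * j) \<noteq> 0}"
  let ?M = "vM m (2 * N)"
  have q: "even_sum m N \<le> ?M" "3 * even_sum m N \<le> ?M"
    using even_sum_le[of N] by auto
  \<comment> \<open>The largest summand of the order is split off first; the remaining frequencies
    are a shifted copy of the preceding kernel.\<close>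
  have "dirichlet m (even_sum m (Suc N)) x =
      dirichlet m ?M x + vpoly m (\<lambda>_. 1) {?M..<?M + even_sum m N} x"
    using vpoly_ivl_add[of 0 ?M "even_sum m (Suc N)" m "\<lambda>_. 1" x]
    by (simp add: even_sum_def lessThan_atLeast0 add.commute)
  also have "vpoly m (\<lambda>_. 1) {?M..<?M + even_sum m N} x = vilenkin m ?M x * dirichlet m (even_sum m N) x"
    by (rule vpoly_block[OF dvd_refl q(1)])
  finally have D: "dirichlet m (even_sum m (Suc N)) x =
    dirichlet m ?M x + vilenkin m ?M x * dirichlet m (even_sum m N) x" .
  show ?case
  \<comment> \<open>Either the new kernel vanishes at \<open>x\<close> and a unimodular factor is
    all that changes, or \<open>x\<close> lies in no earlier \<open>?B j\<close> and the new term
    alone gives the bound.\<close>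
  proof (cases "\<forall>i<2 * N. x i = 0")
    case False
    then have "dirichlet m ?M x = 0" "x \<notin> ?B N"
      using dirichlet_vM[OF x, of "2 * N"] by auto
    then show ?thesis
      using Suc D by (simp add: norm_mult)
  next
    case True
    then have "x \<notin> ?B j" if "j < N" for j
      using that by auto
    then have zero: "(\<Sum>j<N. 2 / 3 * real (vM m (2 * j)) * indicator (?B j) x) = 0"
      by (intro sum.neutral) auto
    have "norm (dirichlet m ?M x) - norm (vilenkin m ?M x * dirichlet m (even_sum m N) x)
        \<le> norm (dirichlet m (even_sum m (Suc N)) x)"
      unfolding D by (rule norm_diff_ineq)
    moreover have "norm (dirichlet m ?M x) = real ?M"
      using True by (simp add: dirichlet_vM[OF x])
    moreover have "norm (vilenkin m ?M x * dirichlet m (even_sum m N) x) \<le> real (even_sum m N)"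
      by (simp add: norm_mult norm_dirichlet_le)
    moreover have "3 * real (even_sum m N) \<le> real ?M"
      using q(2) by linarith
    ultimately have "2 / 3 * real ?M \<le> norm (dirichlet m (even_sum m (Suc N)) x)"
      by linarith
    moreover have "2 / 3 * real ?M * indicator (?B N) x \<le> 2 / 3 * real ?M"
      by (auto simp: indicator_def)
    ultimately show ?thesis
      using zero by simp
  qed
qed simp

text \<open>The set \<open>B j\<close> has measure at least \<open>1 / (2 * vM m (2 * j))\<close>,
  so each summand of the pointwise bound contributes at least \<open>1 / 3\<close>.\<close>

lemma nn_integral_dirichlet_even_sum_ge:
  "ennreal (real N / 3) \<le> (\<integral>\<^sup>+ x. norm (dirichlet m (even_sum m N) x) \<partial>haar m)"
proof -
  interpret prob_space "haar m" by (rule prob_space_haar)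
  define B where "B = (\<lambda>j. vint m (2 * j) (\<lambda>_. 0) - vint m (Suc (2 * j)) (\<lambda>_. 0))"
  note z = zero_vgroup[of m, OF m2]
  note vint_sets[OF z, measurable]
  have B_sets [measurable]: "B j \<in> sets (haar m)" for j
    unfolding B_def by measurable
  have mass: "ennreal (1 / 3) \<le> ennreal (2 / 3 * real (vM m (2 * j))) * emeasure (haar m) (B j)" for j
  proof -
    let ?M = "real (vM m (2 * j))" and ?M' = "real (vM m (Suc (2 * j)))"
    have pos: "?M > 0"
      using vM_pos[of m "2 * j", OF m2] by simp
    have le: "2 * ?M \<le> ?M'"
      using double_vM_le[of "2 * j"] by (metis of_nat_le_iff of_nat_mult of_nat_numeral)
    have "1 / ?M' \<le> 1 / (2 * ?M)"
      using le pos by (intro divide_left_mono) auto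
    then have "1 / (2 * ?M) \<le> 1 / ?M - 1 / ?M'"
      by simp
    then have "2 / 3 * ?M * (1 / (2 * ?M)) \<le> 2 / 3 * ?M * (1 / ?M - 1 / ?M')"
      using pos by (intro mult_left_mono) auto
    then have "ennreal (1 / 3) \<le> ennreal (2 / 3 * ?M * (1 / ?M - 1 / ?M'))"
      using pos by (intro ennreal_leI) simp
    also have "\<dots> = ennreal (2 / 3 * ?M) * ennreal (1 / ?M - 1 / ?M')"
      by (rule ennreal_mult') simp
    also have "ennreal (1 / ?M - 1 / ?M') = ennreal (1 / ?M) - ennreal (1 / ?M')"
      by (rule ennreal_minus[symmetric]) simp
    also have "\<dots> = emeasure (haar m) (vint m (2 * j) (\<lambda>_. 0)) - emeasure (haar m) (vint m (Suc (2 * j)) (\<lambda>_. 0))"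
      by (simp only: emeasure_haar_vint[OF z])
    also have "\<dots> = emeasure (haar m) (B j)"
      unfolding B_def
    proof (rule emeasure_Diff[symmetric])
      show "vint m (Suc (2 * j)) (\<lambda>_. 0) \<subseteq> vint m (2 * j) (\<lambda>_. 0)"
        by (auto simp: vint_def)
    qed (use vint_sets[OF z] emeasure_finite in auto)
    finally show ?thesis .
  qed
  have "real N / 3 = (\<Sum>j<N. 1 / 3)"
    by simp
  then have "ennreal (real N / 3) = (\<Sum>j<N. ennreal (1 / 3))"
    by (simp only: sum_ennreal)
  also have "\<dots> \<le> (\<Sum>j<N. ennreal (2 / 3 * real (vM m (2 * j))) * emeasure (haar m) (B j))"
    by (intro sum_mono mass)
  also have "\<dots> = (\<Sum>j<N. \<integral>\<^sup>+ x. ennreal (2 / 3 * real (vM m (2 * j))) * indicator (B j) x \<partial>haar m)"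
    by (simp only: nn_integral_cmult_indicator[OF B_sets])
  also have "\<dots> = (\<integral>\<^sup>+ x. (\<Sum>j<N. ennreal (2 / 3 * real (vM m (2 * j))) * indicator (B j) x) \<partial>haar m)"
    by (rule nn_integral_sum[symmetric]) measurable
  also have "\<dots> \<le> (\<integral>\<^sup>+ x. norm (dirichlet m (even_sum m N) x) \<partial>haar m)"
  proof (rule nn_integral_mono)
    fix x assume "x \<in> space (haar m)"
    then have x: "x \<in> vgroup m" by simp
    have "(\<Sum>j<N. ennreal (2 / 3 * real (vM m (2 * j))) * indicator (B j) x) =
      (\<Sum>j<N. ennreal (2 / 3 * real (vM m (2 * j)) * indicator {x. (\<forall>i<2 * j. x i = 0) \<and> x (2 * j) \<noteq> 0} x))"
      using x by (intro sum.cong) (auto simp: B_def vint_def indicator_def less_Suc_eq)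
    also have "\<dots> = ennreal (\<Sum>j<N. 2 / 3 * real (vM m (2 * j)) * indicator {x. (\<forall>i<2 * j. x i = 0) \<and> x (2 * j) \<noteq> 0} x)"
      by (rule sum_ennreal) simp
    also have "\<dots> \<le> ennreal (norm (dirichlet m (even_sum m N) x))"
      by (intro ennreal_leI norm_dirichlet_even_sum_ge[OF x])
    finally show "(\<Sum>j<N. ennreal (2 / 3 * real (vM m (2 * j))) * indicator (B j) x) \<le>
      ennreal (norm (dirichlet m (even_sum m N) x))" .
  qed
  finally show ?thesis .
qed

text \<open>Up to a unimodular factor, the kernel of order \<open>?q\<close> is the full level block
  minus the tail. The block has norm 1, so the tail has norm at least \<open>vM m l / 3 - 1\<close>,
  and the weight \<open>1 / vM m l\<close> turns this into
  \<open>1 / 3 - 1 / vM m l\<close>.\<close>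

lemma nn_integral_gap_remainder_ge:
  assumes "2 \<le> l"
  defines "s \<equiv> 2 * vM m l"
  shows "ennreal (1 / 12) \<le>
    (\<integral>\<^sup>+ x. norm (vpoly m (gap_coeff m) {vM m s + even_sum m (vM m l)..<vM m (Suc s)} x) \<partial>haar m)"
proof -
  let ?q = "even_sum m (vM m l)" and ?M = "vM m s"
  define X where "X = (\<integral>\<^sup>+ x. norm (vpoly m (\<lambda>_. 1) {?M + ?q..<?M + ?M} x) \<partial>haar m)"
  have q: "?q \<le> ?M"
    using even_sum_le[of "vM m l"] by (simp add: s_def)
  \<comment> \<open>With \<open>vM m l \<ge> 4\<close> the bound \<open>1 / 3 - 1 / vM m l\<close>
    is at least \<open>1 / 12\<close>; this is why \<open>l \<ge> 2\<close> is assumed.\<close>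
  have "4 \<le> vM m 2"
    using mult_mono[OF m2[of 0] m2[of 1]] by (simp add: vM_def numeral_2_eq_2 mult.commute)
  then have l: "4 \<le> vM m l"
    using vM_mono[of m 2 l, OF m2 assms(1)] by linarith
  have "ennreal (real (vM m l) / 3) \<le> (\<integral>\<^sup>+ x. norm (dirichlet m ?q x) \<partial>haar m)"
    by (rule nn_integral_dirichlet_even_sum_ge)
  also have "\<dots> \<le> (\<integral>\<^sup>+ x. ennreal (norm (dirichlet m ?M x)) + ennreal (norm (vpoly m (\<lambda>_. 1) {?M + ?q..<?M + ?M} x)) \<partial>haar m)"
  proof (rule nn_integral_mono)
    fix x
    have "vpoly m (\<lambda>_. 1) {?M..<?M + ?q} x = vpoly m (\<lambda>_. 1) {?M..<?M + ?M} x - vpoly m (\<lambda>_. 1) {?M + ?q..<?M + ?M} x"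
      using vpoly_ivl_add[of ?M "?M + ?q" "?M + ?M" m "\<lambda>_. 1" x] q by (simp add: algebra_simps)
    then have "norm (dirichlet m ?q x) \<le> norm (dirichlet m ?M x) + norm (vpoly m (\<lambda>_. 1) {?M + ?q..<?M + ?M} x)"
      using norm_triangle_ineq4 by (metis norm_dirichlet_shift q order_refl)
    then show "ennreal (norm (dirichlet m ?q x)) \<le>
      ennreal (norm (dirichlet m ?M x)) + ennreal (norm (vpoly m (\<lambda>_. 1) {?M + ?q..<?M + ?M} x))"
      by (simp flip: ennreal_plus)
  qed
  also have "\<dots> = 1 + X"
    by (simp add: nn_integral_add nn_integral_dirichlet_vM X_def)
  finally have X: "ennreal (real (vM m l) / 3) \<le> 1 + X" .
  have X_ge: "ennreal (real (vM m l) / 3 - 1) \<le> X"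
  proof (cases X)
    case (real r)
    then have "ennreal (real (vM m l) / 3) \<le> ennreal (1 + r)"
      using X by simp
    then have "real (vM m l) / 3 \<le> 1 + r"
      using real by (subst (asm) ennreal_le_iff) auto
    then show ?thesis
      using real by (auto intro: ennreal_leI)
  qed simp
  have "1 / real (vM m l) \<le> 1 / 4"
    using l by (intro divide_left_mono) auto
  moreover have "gap_weight m s * (real (vM m l) / 3 - 1) = 1 / 3 - 1 / real (vM m l)"
    unfolding s_def gap_weight_vM using l by (simp add: right_diff_distrib)
  ultimately have "1 / 12 \<le> gap_weight m s * (real (vM m l) / 3 - 1)"
    by linarith
  then have "ennreal (1 / 12) \<le> ennreal (gap_weight m s * (real (vM m l) / 3 - 1))"
    by (rule ennreal_leI)
  also have "\<dots> = ennreal (gap_weight m s) * ennreal (real (vM m l) / 3 - 1)"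
    by (rule ennreal_mult') (rule gap_weight_nonneg)
  also have "\<dots> \<le> ennreal (gap_weight m s) * X"
    by (intro mult_left_mono X_ge) simp
  also have "\<dots> = (\<integral>\<^sup>+ x. ennreal (gap_weight m s) * ennreal (norm (vpoly m (\<lambda>_. 1) {?M + ?q..<?M + ?M} x)) \<partial>haar m)"
    unfolding X_def by (rule nn_integral_cmult[symmetric]) measurable
  also have "\<dots> = (\<integral>\<^sup>+ x. norm (vpoly m (gap_coeff m) {?M + ?q..<vM m (Suc s)} x) \<partial>haar m)"
  proof (rule nn_integral_cong)
    fix x
    have "{?M + ?q..<vM m (Suc s)} \<inter> {..<2 * ?M} = {?M + ?q..<?M + ?M}"
      using double_vM_le[of s] by auto
    then show "ennreal (gap_weight m s) * ennreal (norm (vpoly m (\<lambda>_. 1) {?M + ?q..<?M + ?M} x)) =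
      ennreal (norm (vpoly m (gap_coeff m) {?M + ?q..<vM m (Suc s)} x))"
      using gap_weight_nonneg[of m s] by (simp add: gap_vpoly_eq[of s] norm_mult ennreal_mult)
  qed
  finally show ?thesis .
qed

section \<open>The lacunary counterexample\<close>

lemma psum_not_tendsto_L1:
  "\<exists>f\<in>H1 m.
    (\<exists>C>0. \<forall>\<^sub>F n in sequentially. omega_H1 m (2 * vM m n) f \<le> ennreal (C * (1 / real (vM m n)))) \<and>
    \<not> (\<lambda>k. mart_L1_norm m (mart_diff (mart_of m (mart_psum m k f)) f)) \<longlonglongrightarrow> 0"
proof -
  define f where "f = (\<lambda>n. vpoly m (gap_coeff m) {..<vM m n})"
  have f: "is_vmart m f"
    unfolding f_def by (rule is_vmart_vpoly)
  have coeff: "mart_fcoeff m f = gap_coeff m"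
    unfolding f_def by (rule ext) (rule mart_fcoeff_vpoly)
  \<comment> \<open>Because \<open>vM m 0 = 1\<close>, a vanishing coefficient at 0 makes
    \<open>f\<close> its own remainder from level 0, so the remainder bound also shows membership in
    \<open>H1 m\<close>.\<close>
  have "gap_coeff m 0 = 0"
    by (simp add: gap_coeff_def)
  then have "f = (\<lambda>j. vpoly m (gap_coeff m) {vM m 0..<vM m j})"
    unfolding f_def vpoly_def fun_eq_iff by (auto intro!: sum.mono_neutral_right simp: not_le)
  then have "H1_norm m f \<le> ennreal (2 / real (vM m 0))"
    using H1_norm_gap_remainder_le[OF sum_gap_weight_shift_le[of 0 0]] by simp
  then have "f \<in> H1 m"
    using f le_less_trans by (fastforce simp: H1_def)
  moreover have "omega_H1 m (2 * vM m n) f \<le> ennreal (2 * (1 / real (vM m n)))" for n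
  proof -
    have "n \<le> l" if "2 * vM m n \<le> 2 * vM m l" for l
    proof (rule ccontr)
      assume "\<not> n \<le> l"
      then have "vM m (Suc l) \<le> vM m n"
        using m2 by (intro vM_mono) auto
      then show False
        using that double_vM_le[of l] vM_pos[of m l, OF m2] by linarith
    qed
    then show ?thesis
      using H1_norm_gap_remainder_le[OF sum_gap_weight_shift_le[of "2 * vM m n" n]]
      by (simp add: omega_H1_def H1_norm_mart_diff_psum(2)[OF f] coeff)
  qed
  moreover have "\<not> (\<lambda>k. mart_L1_norm m (mart_diff (mart_of m (mart_psum m k f)) f)) \<longlonglongrightarrow> 0"
  proof
    assume "(\<lambda>k. mart_L1_norm m (mart_diff (mart_of m (mart_psum m k f)) f)) \<longlonglongrightarrow> 0"
    then have "\<forall>\<^sub>F k in sequentially. mart_L1_norm m (mart_diff (mart_of m (mart_psum m k f)) f) < ennreal (1 / 12)"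
      by (rule order_tendstoD) simp
    then obtain K where K: "\<And>k. k \<ge> K \<Longrightarrow> mart_L1_norm m (mart_diff (mart_of m (mart_psum m k f)) f) < ennreal (1 / 12)"
      by (auto simp: eventually_sequentially)
    \<comment> \<open>The summand 2 secures \<open>l \<ge> 2\<close>, and \<open>l \<ge> K\<close>
      places the stopping index \<open>k\<close> beyond \<open>K\<close>.\<close>
    define l where "l = K + 2"
    define s where "s = 2 * vM m l"
    define k where "k = vM m s + even_sum m (vM m l)"
    have "K \<le> k"
      using vM_gt[of m l, OF m2] vM_gt[of m s, OF m2] by (simp add: k_def s_def l_def)
    have "ennreal (1 / 12) \<le> (\<integral>\<^sup>+ x. norm (vpoly m (gap_coeff m) {k..<vM m (Suc s)} x) \<partial>haar m)"
      unfolding k_def s_def by (rule nn_integral_gap_remainder_ge) (simp add: l_def)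
    also have "\<dots> = (\<integral>\<^sup>+ x. norm (mart_diff (mart_of m (mart_psum m k f)) f (Suc s) x) \<partial>haar m)"
      by (intro nn_integral_cong) (simp add: norm_mart_diff_psum(1)[OF f] coeff)
    \<comment> \<open>The norm is a supremum over levels, so the single level \<open>Suc s\<close>,
      where the block is complete, already gives the lower bound.\<close>
    also have "\<dots> \<le> mart_L1_norm m (mart_diff (mart_of m (mart_psum m k f)) f)"
      unfolding mart_L1_norm_def by (rule SUP_upper) simp
    finally show False
      using K[OF \<open>K \<le> k\<close>] by simp
  qed
  ultimately show ?thesis
    by (intro bexI[of _ f] conjI exI[of _ "2 :: real"]) (auto simp: eventually_sequentially)
qed

end

theorem theorem2p24:
  fixes m :: "nat \<Rightarrow> nat"
  assumes "\<And>k. m k \<ge> 2" and "bdd_above (range m)"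
  shows "(\<forall>f\<in>H1 m.
            (\<forall>c>0. \<forall>\<^sub>F n in sequentially. omega_H1 m n f \<le> ennreal (c * (1 / real n))) \<longrightarrow>
            (\<lambda>k. H1_norm m (mart_diff (mart_of m (mart_psum m k f)) f)) \<longlonglongrightarrow> 0)
       \<and> (\<exists>f\<in>H1 m.
            (\<exists>C>0. \<forall>\<^sub>F n in sequentially.
               omega_H1 m (2 * vM m n) f \<le> ennreal (C * (1 / real (vM m n)))) \<and>
            \<not> (\<lambda>k. mart_L1_norm m (mart_diff (mart_of m (mart_psum m k f)) f)) \<longlonglongrightarrow> 0)"
proof (intro conjI ballI impI)
  fix f
  assume "f \<in> H1 m" "\<forall>c>0. \<forall>\<^sub>F n in sequentially. omega_H1 m n f \<le> ennreal (c * (1 / real n))"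
  then show "(\<lambda>k. H1_norm m (mart_diff (mart_of m (mart_psum m k f)) f)) \<longlonglongrightarrow> 0"
    using assms(2) by (intro psum_tendsto_H1[of m, OF assms(1)]) (auto simp: H1_def)
qed (rule psum_not_tendsto_L1[of m, OF assms(1)])

end
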